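(* Let $\mathcal{A}$ be a structure for a computable language $L$ (the structure $\mathcal{A}$ need not have a computable copy). Let $\alpha\geq 2$ be a computable ordinal. If $\mathcal{A}$ has a computable $\Pi_\alpha$ Scott sentence, then for each finite tuple from $\mathcal{A}$ its orbit under the automorphism group of $\mathcal{A}$ is defined in $\mathcal{A}$ (without parameters) by a computable $\Sigma_{<\alpha}$ formula.
   Context: Structures are countably infinite with universe $\omega$. Computable infinitary formulas are formulas of $L_{\omega_1\omega}$ (with finitely many free variables) in which the infinite disjunctions and conjunctions are over c.e. sets. Precisely, for a computable ordinal $\alpha$ one fixes a notation for $\alpha$ in Kleene's $\mathcal{O}$, ordinals $\beta<\alpha$ being represented by the notations below it. A formula is computable $\Sigma_0$ and computable $\Pi_0$ if it is finitary quantifier-free. For $\alpha>0$, a computable $\Sigma_\alpha$ formula $\varphi(\bar x)$ is the disjunction of a c.e. set (a c.e. set of indices) of formulas $(\exists\bar u)\psi(\bar x,\bar u)$, where each $\psi$ is computable $\Pi_\beta$ for some $\beta<\alpha$; a computable $\Pi_\alpha$ formula $\varphi(\bar x)$ is the conjunction of a c.e. set of formulas $(\forall\bar u)\psi(\bar x,\bar u)$, where each $\psi$ is computable $\Sigma_\beta$ for some $\beta<\alpha$. Here an index of a computable $\Sigma_\alpha$ (resp. $\Pi_\alpha$) formula records $\Sigma$ (resp. $\Pi$), the notation, the tuple of free variables, and a c.e. index for the set of pairs (index of $\psi$, tuple $\bar u$). A formula is computable $\Sigma_{<\alpha}$ if it is computable $\Sigma_\beta$ for some $\beta<\alpha$.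 A Scott sentence for $\mathcal{A}$ is a sentence of $L_{\omega_1\omega}$ whose countable models are exactly the isomorphic copies of $\mathcal{A}$. *)

theory Defs
  imports Complex_Main "HOL-Library.Nat_Bijection"
begin

unbundle cardinal_syntax

section \<open>Partial recursive functions and c.e. sets\<close>

text \<open>Unary partial recursive functions on the naturals, with several arguments coded by the
  Cantor pairing function \<^const>\<open>prod_encode\<close>.\<close>

datatype code =
    CZero
  | CSucc
  | CFst
  | CSnd
  | CPair code code
  | CComp code code
  | CPrec code code
  | CMu code

inductive computes :: "code \<Rightarrow> nat \<Rightarrow> nat \<Rightarrow> bool" where
  zero: "computes CZero x 0"
| succ: "computes CSucc x (Suc x)"
| fst: "computes CFst (prod_encode (x, y)) x"
| snd: "computes CSnd (prod_encode (x, y)) y"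
| pair: "computes p x y \<Longrightarrow> computes q x z \<Longrightarrow> computes (CPair p q) x (prod_encode (y, z))"
| comp: "computes q x y \<Longrightarrow> computes p y z \<Longrightarrow> computes (CComp p q) x z"
| prec_0: "computes p x y \<Longrightarrow> computes (CPrec p q) (prod_encode (x, 0)) y"
| prec_Suc: "computes (CPrec p q) (prod_encode (x, n)) y \<Longrightarrow>
    computes q (prod_encode (x, prod_encode (n, y))) z \<Longrightarrow>
    computes (CPrec p q) (prod_encode (x, Suc n)) z"
| mu: "computes p (prod_encode (x, n)) 0 \<Longrightarrow>
    (\<And>m. m < n \<Longrightarrow> \<exists>k. computes p (prod_encode (x, m)) (Suc k)) \<Longrightarrow>
    computes (CMu p) x n"

primrec code_num :: "code \<Rightarrow> nat" where
  "code_num CZero = prod_encode (0, 0)"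
| "code_num CSucc = prod_encode (1, 0)"
| "code_num CFst = prod_encode (2, 0)"
| "code_num CSnd = prod_encode (3, 0)"
| "code_num (CPair p q) = prod_encode (4, prod_encode (code_num p, code_num q))"
| "code_num (CComp p q) = prod_encode (5, prod_encode (code_num p, code_num q))"
| "code_num (CPrec p q) = prod_encode (6, prod_encode (code_num p, code_num q))"
| "code_num (CMu p) = prod_encode (7, code_num p)"

text \<open>\<open>phi e x y\<close> says that the \<open>e\<close>-th partial recursive function is defined at \<open>x\<close> with value
  \<open>y\<close>; a number that codes no program names the empty function.\<close>

definition phi :: "nat \<Rightarrow> nat \<Rightarrow> nat \<Rightarrow> bool" where
  "phi e x y \<longleftrightarrow> (\<exists>p. code_num p = e \<and> computes p x y)"

definition W :: "nat \<Rightarrow> nat set" where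
  "W e = {x. \<exists>y. phi e x y}"

definition computable_fun_on :: "nat set \<Rightarrow> (nat \<Rightarrow> nat) \<Rightarrow> bool" where
  "computable_fun_on S f \<longleftrightarrow> (\<exists>e. \<forall>x\<in>S. phi e x (f x))"

definition computable_set :: "nat set \<Rightarrow> bool" where
  "computable_set S \<longleftrightarrow> computable_fun_on UNIV (\<lambda>x. if x \<in> S then 1 else 0)"


section \<open>Kleene's system of ordinal notations\<close>

inductive in_O :: "nat \<Rightarrow> bool" and less_O :: "nat \<Rightarrow> nat \<Rightarrow> bool" where
  in_O_zero: "in_O 1"
| in_O_succ: "in_O a \<Longrightarrow> in_O (2 ^ a)"
| in_O_lim: "(\<And>n. phi e n (f n)) \<Longrightarrow> (\<And>n. in_O (f n)) \<Longrightarrow>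
    (\<And>n. less_O (f n) (f (Suc n))) \<Longrightarrow> in_O (3 * 5 ^ e)"
| less_O_succ: "in_O a \<Longrightarrow> less_O a (2 ^ a)"
| less_O_lim: "(\<And>n. phi e n (f n)) \<Longrightarrow> (\<And>n. in_O (f n)) \<Longrightarrow>
    (\<And>n. less_O (f n) (f (Suc n))) \<Longrightarrow> less_O (f k) (3 * 5 ^ e)"
| less_O_trans: "less_O a b \<Longrightarrow> less_O b c \<Longrightarrow> less_O a c"

text \<open>The ordinal with notation \<open>a\<close>, given as the well-order of the notations below \<open>a\<close>.\<close>

definition ord_O :: "nat \<Rightarrow> nat rel" where
  "ord_O a = {(b, c). less_O b a \<and> less_O c a \<and> (b = c \<or> less_O b c)}"


section \<open>Languages and structures\<close>

text \<open>Symbols are natural numbers; constants are function symbols of arity 0.\<close>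

record lang =
  rel_syms :: "nat set"
  fun_syms :: "nat set"
  rel_arity :: "nat \<Rightarrow> nat"
  fun_arity :: "nat \<Rightarrow> nat"

definition computable_lang :: "lang \<Rightarrow> bool" where
  "computable_lang L \<longleftrightarrow>
    computable_set (rel_syms L) \<and> computable_fun_on (rel_syms L) (rel_arity L) \<and>
    computable_set (fun_syms L) \<and> computable_fun_on (fun_syms L) (fun_arity L)"

text \<open>All structures have universe \<open>\<omega>\<close>, i.e. all of \<^typ>\<open>nat\<close>. The values of an interpretation
  at symbols outside the language, or at lists of the wrong length, are irrelevant.\<close>

record struct =
  rel_int :: "nat \<Rightarrow> nat list \<Rightarrow> bool"
  fun_int :: "nat \<Rightarrow> nat list \<Rightarrow> nat"

definition isomorphism :: "lang \<Rightarrow> struct \<Rightarrow> struct \<Rightarrow> (nat \<Rightarrow> nat) \<Rightarrow> bool" where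
  "isomorphism L A B h \<longleftrightarrow> bij h \<and>
    (\<forall>r\<in>rel_syms L. \<forall>xs. length xs = rel_arity L r \<longrightarrow>
      rel_int B r (map h xs) = rel_int A r xs) \<and>
    (\<forall>f\<in>fun_syms L. \<forall>xs. length xs = fun_arity L f \<longrightarrow>
      fun_int B f (map h xs) = h (fun_int A f xs))"

definition isomorphic :: "lang \<Rightarrow> struct \<Rightarrow> struct \<Rightarrow> bool" where
  "isomorphic L A B \<longleftrightarrow> (\<exists>h. isomorphism L A B h)"

definition orbit :: "lang \<Rightarrow> struct \<Rightarrow> nat list \<Rightarrow> nat list set" where
  "orbit L A as = {map h as | h. isomorphism L A A h}"


section \<open>Formulas of $L_{\omega_1\omega}$\<close>

datatype trm = Var nat | App nat "trm list"

text \<open>A countable conjunction or disjunction is given by a family of formulas together with a set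
  of natural numbers as its index set; members of the family outside that set do not matter.\<close>

datatype form =
    Eq trm trm
  | Rel nat "trm list"
  | Neg form
  | And form form
  | Or form form
  | Conj "nat set" "nat \<Rightarrow> form"
  | Disj "nat set" "nat \<Rightarrow> form"
  | Ex nat form
  | All nat form

primrec tm_vars :: "trm \<Rightarrow> nat set" where
  "tm_vars (Var x) = {x}"
| "tm_vars (App f ts) = \<Union> (set (map tm_vars ts))"

primrec free_vars :: "form \<Rightarrow> nat set" where
  "free_vars (Eq s t) = tm_vars s \<union> tm_vars t"
| "free_vars (Rel r ts) = (\<Union>t\<in>set ts. tm_vars t)"
| "free_vars (Neg \<phi>) = free_vars \<phi>"
| "free_vars (And \<phi> \<psi>) = free_vars \<phi> \<union> free_vars \<psi>"
| "free_vars (Or \<phi> \<psi>) = free_vars \<phi> \<union> free_vars \<psi>"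
| "free_vars (Conj I \<Phi>) = (\<Union>i\<in>I. free_vars (\<Phi> i))"
| "free_vars (Disj I \<Phi>) = (\<Union>i\<in>I. free_vars (\<Phi> i))"
| "free_vars (Ex x \<phi>) = free_vars \<phi> - {x}"
| "free_vars (All x \<phi>) = free_vars \<phi> - {x}"

fun wf_trm :: "lang \<Rightarrow> trm \<Rightarrow> bool" where
  "wf_trm L (Var x) = True"
| "wf_trm L (App f ts) =
    (f \<in> fun_syms L \<and> length ts = fun_arity L f \<and> (\<forall>t\<in>set ts. wf_trm L t))"

primrec wf_form :: "lang \<Rightarrow> form \<Rightarrow> bool" where
  "wf_form L (Eq s t) = (wf_trm L s \<and> wf_trm L t)"
| "wf_form L (Rel r ts) =
    (r \<in> rel_syms L \<and> length ts = rel_arity L r \<and> (\<forall>t\<in>set ts. wf_trm L t))"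
| "wf_form L (Neg \<phi>) = wf_form L \<phi>"
| "wf_form L (And \<phi> \<psi>) = (wf_form L \<phi> \<and> wf_form L \<psi>)"
| "wf_form L (Or \<phi> \<psi>) = (wf_form L \<phi> \<and> wf_form L \<psi>)"
| "wf_form L (Conj I \<Phi>) = (\<forall>i\<in>I. wf_form L (\<Phi> i))"
| "wf_form L (Disj I \<Phi>) = (\<forall>i\<in>I. wf_form L (\<Phi> i))"
| "wf_form L (Ex x \<phi>) = wf_form L \<phi>"
| "wf_form L (All x \<phi>) = wf_form L \<phi>"

primrec tm_val :: "struct \<Rightarrow> (nat \<Rightarrow> nat) \<Rightarrow> trm \<Rightarrow> nat" where
  "tm_val A s (Var x) = s x"
| "tm_val A s (App f ts) = fun_int A f (map (tm_val A s) ts)"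

primrec sat :: "struct \<Rightarrow> form \<Rightarrow> (nat \<Rightarrow> nat) \<Rightarrow> bool" where
  "sat A (Eq t u) = (\<lambda>s. tm_val A s t = tm_val A s u)"
| "sat A (Rel r ts) = (\<lambda>s. rel_int A r (map (tm_val A s) ts))"
| "sat A (Neg \<phi>) = (\<lambda>s. \<not> sat A \<phi> s)"
| "sat A (And \<phi> \<psi>) = (\<lambda>s. sat A \<phi> s \<and> sat A \<psi> s)"
| "sat A (Or \<phi> \<psi>) = (\<lambda>s. sat A \<phi> s \<or> sat A \<psi> s)"
| "sat A (Conj I \<Phi>) = (\<lambda>s. \<forall>i\<in>I. sat A (\<Phi> i) s)"
| "sat A (Disj I \<Phi>) = (\<lambda>s. \<exists>i\<in>I. sat A (\<Phi> i) s)"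
| "sat A (Ex x \<phi>) = (\<lambda>s. \<exists>a. sat A \<phi> (s(x := a)))"
| "sat A (All x \<phi>) = (\<lambda>s. \<forall>a. sat A \<phi> (s(x := a)))"

abbreviation Exs :: "nat list \<Rightarrow> form \<Rightarrow> form" where
  "Exs us \<phi> \<equiv> foldr Ex us \<phi>"

abbreviation Alls :: "nat list \<Rightarrow> form \<Rightarrow> form" where
  "Alls us \<phi> \<equiv> foldr All us \<phi>"

definition sentence :: "lang \<Rightarrow> form \<Rightarrow> bool" where
  "sentence L \<phi> \<longleftrightarrow> wf_form L \<phi> \<and> free_vars \<phi> = {}"

definition models :: "struct \<Rightarrow> form \<Rightarrow> bool" where
  "models A \<phi> \<longleftrightarrow> (\<forall>s. sat A \<phi> s)"

text \<open>As structures have universe \<open>\<omega>\<close>, finite models are not considered. Excluding them by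
  requiring that \<open>\<phi>\<close> have none would only shrink the class of Scott sentences.\<close>

definition scott_sentence :: "lang \<Rightarrow> struct \<Rightarrow> form \<Rightarrow> bool" where
  "scott_sentence L A \<phi> \<longleftrightarrow> sentence L \<phi> \<and> (\<forall>B. models B \<phi> \<longleftrightarrow> isomorphic L A B)"

definition defines_in :: "struct \<Rightarrow> nat list \<Rightarrow> form \<Rightarrow> nat list set \<Rightarrow> bool" where
  "defines_in A xs \<phi> X \<longleftrightarrow> distinct xs \<and> free_vars \<phi> \<subseteq> set xs \<and>
    X = {map s xs | s. sat A \<phi> s}"


section \<open>Computable infinitary formulas\<close>

inductive finitary_qf :: "form \<Rightarrow> bool" where
  "finitary_qf (Eq s t)"
| "finitary_qf (Rel r ts)"
| "finitary_qf \<phi> \<Longrightarrow> finitary_qf (Neg \<phi>)"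
| "finitary_qf \<phi> \<Longrightarrow> finitary_qf \<psi> \<Longrightarrow> finitary_qf (And \<phi> \<psi>)"
| "finitary_qf \<phi> \<Longrightarrow> finitary_qf \<psi> \<Longrightarrow> finitary_qf (Or \<phi> \<psi>)"

primrec tm_num :: "trm \<Rightarrow> nat" where
  "tm_num (Var x) = prod_encode (0, x)"
| "tm_num (App f ts) = prod_encode (1, prod_encode (f, list_encode (map tm_num ts)))"

text \<open>Goedel numbers; the dummy value 0 on the last four constructors is never used, since the
  function is applied to finitary quantifier-free formulas only.\<close>

primrec form_num :: "form \<Rightarrow> nat" where
  "form_num (Eq s t) = prod_encode (0, prod_encode (tm_num s, tm_num t))"
| "form_num (Rel r ts) = prod_encode (1, prod_encode (r, list_encode (map tm_num ts)))"
| "form_num (Neg \<phi>) = prod_encode (2, form_num \<phi>)"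
| "form_num (And \<phi> \<psi>) = prod_encode (3, prod_encode (form_num \<phi>, form_num \<psi>))"
| "form_num (Or \<phi> \<psi>) = prod_encode (4, prod_encode (form_num \<phi>, form_num \<psi>))"
| "form_num (Conj I \<Phi>) = 0"
| "form_num (Disj I \<Phi>) = 0"
| "form_num (Ex x \<phi>) = 0"
| "form_num (All x \<phi>) = 0"

datatype kind = SigmaK | PiK

text \<open>The index recording the kind, the notation \<open>a\<close>, the tuple \<open>xs\<close> of free variables, and a
  number \<open>e\<close>: the Goedel number of a finitary formula if \<open>a\<close> is the notation 1 of the ordinal 0,
  and a c.e. index otherwise.\<close>

definition index :: "kind \<Rightarrow> nat \<Rightarrow> nat list \<Rightarrow> nat \<Rightarrow> nat" where
  "index K a xs e =
    prod_encode (case K of SigmaK \<Rightarrow> 0 | PiK \<Rightarrow> 1, prod_encode (a, prod_encode (list_encode xs, e)))"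

text \<open>An element \<open>n\<close> of the c.e. set of an index codes the pair of the index \<open>part_index n\<close> of a
  formula and the tuple \<open>part_vars n\<close> of variables to be quantified.\<close>

definition part_index :: "nat \<Rightarrow> nat" where
  "part_index n = fst (prod_decode n)"

definition part_vars :: "nat \<Rightarrow> nat list" where
  "part_vars n = list_decode (snd (prod_decode n))"

text \<open>\<open>has_index L K a xs i \<phi>\<close>: the number \<open>i\<close> is an index of kind \<open>K\<close> with notation \<open>a\<close> and free
  variables \<open>xs\<close>, and \<open>\<phi>\<close> is the formula it describes.\<close>

inductive has_index ::
    "lang \<Rightarrow> kind \<Rightarrow> nat \<Rightarrow> nat list \<Rightarrow> nat \<Rightarrow> form \<Rightarrow> bool" for L where
  zero: "finitary_qf \<phi> \<Longrightarrow> wf_form L \<phi> \<Longrightarrow> distinct xs \<Longrightarrow> free_vars \<phi> \<subseteq> set xs \<Longrightarrow>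
    has_index L K 1 xs (index K 1 xs (form_num \<phi>)) \<phi>"
| Sigma: "in_O a \<Longrightarrow> a \<noteq> 1 \<Longrightarrow> distinct xs \<Longrightarrow>
    (\<And>n. n \<in> W e \<Longrightarrow> less_O (b n) a \<and> set (ys n) \<subseteq> set xs \<union> set (part_vars n)) \<Longrightarrow>
    (\<And>n. n \<in> W e \<Longrightarrow> has_index L PiK (b n) (ys n) (part_index n) (\<psi> n)) \<Longrightarrow>
    has_index L SigmaK a xs (index SigmaK a xs e) (Disj (W e) (\<lambda>n. Exs (part_vars n) (\<psi> n)))"
| Pi: "in_O a \<Longrightarrow> a \<noteq> 1 \<Longrightarrow> distinct xs \<Longrightarrow>
    (\<And>n. n \<in> W e \<Longrightarrow> less_O (b n) a \<and> set (ys n) \<subseteq> set xs \<union> set (part_vars n)) \<Longrightarrow>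
    (\<And>n. n \<in> W e \<Longrightarrow> has_index L SigmaK (b n) (ys n) (part_index n) (\<psi> n)) \<Longrightarrow>
    has_index L PiK a xs (index PiK a xs e) (Conj (W e) (\<lambda>n. Alls (part_vars n) (\<psi> n)))"

text \<open>Here the ordinals \<open>\<alpha>\<close> are given by notations \<open>a\<close>.\<close>

definition computable_Sigma :: "lang \<Rightarrow> nat \<Rightarrow> nat list \<Rightarrow> form \<Rightarrow> bool" where
  "computable_Sigma L a xs \<phi> \<longleftrightarrow> (\<exists>i. has_index L SigmaK a xs i \<phi>)"

definition computable_Pi :: "lang \<Rightarrow> nat \<Rightarrow> nat list \<Rightarrow> form \<Rightarrow> bool" where
  "computable_Pi L a xs \<phi> \<longleftrightarrow> (\<exists>i. has_index L PiK a xs i \<phi>)"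

definition computable_Sigma_below :: "lang \<Rightarrow> nat \<Rightarrow> nat list \<Rightarrow> form \<Rightarrow> bool" where
  "computable_Sigma_below L a xs \<phi> \<longleftrightarrow> (\<exists>b. less_O b a \<and> computable_Sigma L b xs \<phi>)"

end

theory Submission
  imports Defs "HOL-Library.Countable_Set"
begin

text \<open>The argument is an effective omitting types theorem. A condition is a finite set of
  constraints on a copy of \<open>A\<close>, each an instance of a quantifier-free formula or of a
  \<open>\<Pi>\<^sub>\<beta>\<close> subformula of the Scott sentence with \<open>\<beta> + 1 < \<alpha>\<close>. The set of tuples of \<open>A\<close> that can
  occupy given places in a copy meeting a condition is definable by a computable \<open>\<Sigma>\<close> formula of
  level below \<open>\<alpha>\<close>. If no such set isolated the type of some tuple, a sufficiently generic sequence
  of conditions would yield a model of the Scott sentence omitting that type, yet this model is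
  isomorphic to \<open>A\<close>. So every type is isolated, and by back and forth an isolating set is an orbit.
  The definability claim needs variables to be renamed effectively throughout a computable
  infinitary formula, which is done with the recursion theorem.\<close>

section \<open>Recursive functions and c.e. sets\<close>

text \<open>The bound \<beta> + 1 < \<alpha> is dictated from two sides. The tuples that can occupy
  given places are described by one existential block in front of a finite conjunction of
  constraints; this raises the level from \<beta> to \<beta> + 1, which must stay below \<alpha>.
  Conversely, a \<Sigma> subformula of level below \<alpha> has disjuncts whose \<Pi> matrix has a
  level \<beta> with \<beta> + 1 < \<alpha>, so its witnesses can still be recorded as constraints.
  The outermost level \<alpha> is universal and calls for no constraint: the Scott sentence holds in
  A, so every condition forces it. A condition counts as consistent when some copy of A meets it, so
  neither proofs nor compactness enter, and for infinitary formulas only the implication from forced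
  to true is established. The generic sequence is chosen without any effectiveness; computability
  matters only for the formula attached to a single finite condition, which is why A need not have a
  computable copy.\<close>

abbreviation pfst :: "nat \<Rightarrow> nat" where "pfst n \<equiv> fst (prod_decode n)"
abbreviation psnd :: "nat \<Rightarrow> nat" where "psnd n \<equiv> snd (prod_decode n)"

lemma computes_CZero [simp]: "computes CZero x y \<longleftrightarrow> y = 0"
  by (auto elim: computes.cases intro: computes.intros)

lemma computes_CSucc [simp]: "computes CSucc x y \<longleftrightarrow> y = Suc x"
  by (auto elim: computes.cases intro: computes.intros)

lemma computes_CFst [simp]: "computes CFst x y \<longleftrightarrow> y = pfst x"
proof
  show "computes CFst x y \<Longrightarrow> y = pfst x"
    by (auto elim: computes.cases)
  show "y = pfst x \<Longrightarrow> computes CFst x y"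
    using computes.fst[of "pfst x" "psnd x"] by simp
qed

lemma computes_CSnd [simp]: "computes CSnd x y \<longleftrightarrow> y = psnd x"
proof
  show "computes CSnd x y \<Longrightarrow> y = psnd x"
    by (auto elim: computes.cases)
  show "y = psnd x \<Longrightarrow> computes CSnd x y"
    using computes.snd[of "pfst x" "psnd x"] by simp
qed

lemma computes_CPair [simp]:
  "computes (CPair p q) x z \<longleftrightarrow> (\<exists>u v. computes p x u \<and> computes q x v \<and> z = prod_encode (u, v))"
  by (auto elim: computes.cases intro: computes.intros)

lemma computes_CComp [simp]:
  "computes (CComp p q) x z \<longleftrightarrow> (\<exists>y. computes q x y \<and> computes p y z)"
  by (auto elim: computes.cases intro: computes.intros)

inductive_cases computes_CPrecE: "computes (CPrec p q) x y"
inductive_cases computes_CMuE: "computes (CMu p) x y"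

lemma computes_functional: "computes p x y \<Longrightarrow> computes p x z \<Longrightarrow> y = z"
proof (induction arbitrary: z rule: computes.induct)
  case (pair p x y q z w)
  then show ?case by (metis computes_CPair)
next
  case (comp q x y p z w)
  then show ?case by (metis computes_CComp)
next
  case (prec_0 p x y q)
  from prec_0.prems show ?case
    by (rule computes_CPrecE) (auto dest: prec_0.IH)
next
  case (prec_Suc p q x n y w)
  from prec_Suc.prems show ?case
    by (rule computes_CPrecE) (auto dest!: prec_Suc.IH(1) intro: prec_Suc.IH(2))
next
  case (mu p x n)
  from mu.prems show ?case
  proof (rule computes_CMuE)
    assume *: "computes p (prod_encode (x, z)) 0"
      "\<And>m. m < z \<Longrightarrow> \<exists>k. computes p (prod_encode (x, m)) (Suc k)"
    show ?thesis
    proof (cases n z rule: linorder_cases)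
      case less
      with *(2) mu.IH(1) show ?thesis by fastforce
    next
      case greater
      with *(1) mu.IH(2) show ?thesis by fastforce
    qed
  qed
qed auto

lemma code_num_inject: "code_num p = code_num q \<Longrightarrow> p = q"
proof (induction p arbitrary: q)
  case CZero then show ?case by (cases q) auto
next
  case CSucc then show ?case by (cases q) auto
next
  case CFst then show ?case by (cases q) auto
next
  case CSnd then show ?case by (cases q) auto
next
  case (CPair p1 p2) then show ?case by (cases q) auto
next
  case (CComp p1 p2) then show ?case by (cases q) auto
next
  case (CPrec p1 p2) then show ?case by (cases q) auto
next
  case (CMu p) then show ?case by (cases q) auto
qed

lemma phi_code_num [simp]: "phi (code_num p) = computes p"
  unfolding phi_def fun_eq_iff using code_num_inject by blast

lemma phi_functional: "phi e x y \<Longrightarrow> phi e x z \<Longrightarrow> y = z"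
  unfolding phi_def using code_num_inject computes_functional by blast

text \<open>5 is the tag of \<open>CComp\<close>. The numbers \<open>e\<close> and \<open>k\<close>
  need not code programs: if one of them does not, both sides are false.\<close>

lemma phi_comp: "phi (prod_encode (5, prod_encode (e, k))) x z \<longleftrightarrow> (\<exists>y. phi k x y \<and> phi e y z)"
proof
  assume "phi (prod_encode (5, prod_encode (e, k))) x z"
  then obtain p where "code_num p = prod_encode (5, prod_encode (e, k))" "computes p x z"
    by (auto simp: phi_def)
  then show "\<exists>y. phi k x y \<and> phi e y z"
    by (cases p) auto
next
  assume "\<exists>y. phi k x y \<and> phi e y z"
  then obtain y p q where "code_num p = k" "computes p x y" "code_num q = e" "computes q y z"
    by (auto simp: phi_def)
  then show "phi (prod_encode (5, prod_encode (e, k))) x z"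
    using phi_code_num[of "CComp q p"] by auto
qed

section \<open>Total recursive functions and the recursion theorem\<close>

definition recursive :: "(nat \<Rightarrow> nat) \<Rightarrow> bool" where
  "recursive f \<longleftrightarrow> (\<exists>p. \<forall>x. computes p x (f x))"

lemma recursive_code: "recursive f \<Longrightarrow> \<exists>p. \<forall>x y. computes p x y \<longleftrightarrow> y = f x"
  unfolding recursive_def using computes_functional by metis

lemma recursiveI: "(\<And>x. computes p x (f x)) \<Longrightarrow> recursive f"
  unfolding recursive_def by blast

lemma recursive_comp: 
  assumes "recursive f" "recursive g"
  shows "recursive (\<lambda>x. f (g x))"
proof -
  obtain p where "\<And>x y. computes p x y \<longleftrightarrow> y = f x" using recursive_code[OF assms(1)] by auto
  moreover obtain q where "\<And>x y. computes q x y \<longleftrightarrow> y = g x" using recursive_code[OF assms(2)] by auto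
  ultimately show ?thesis by (intro recursiveI[of "CComp p q"]) simp
qed

lemma recursive_id: "recursive (\<lambda>x. x)"
  by (rule recursiveI[of "CPair CFst CSnd"]) simp

lemma recursive_pair:
  assumes "recursive f" "recursive g"
  shows "recursive (\<lambda>x. prod_encode (f x, g x))"
proof -
  obtain p where "\<And>x y. computes p x y \<longleftrightarrow> y = f x" using recursive_code[OF assms(1)] by auto
  moreover obtain q where "\<And>x y. computes q x y \<longleftrightarrow> y = g x" using recursive_code[OF assms(2)] by auto
  ultimately show ?thesis by (intro recursiveI[of "CPair p q"]) simp
qed

lemma recursive_pfst: "recursive f \<Longrightarrow> recursive (\<lambda>x. pfst (f x))"
  by (rule recursive_comp[of pfst]) (auto intro: recursiveI[of CFst])

lemma recursive_psnd: "recursive f \<Longrightarrow> recursive (\<lambda>x. psnd (f x))"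
  by (rule recursive_comp[of psnd]) (auto intro: recursiveI[of CSnd])

lemma recursive_Suc: "recursive f \<Longrightarrow> recursive (\<lambda>x. Suc (f x))"
  by (rule recursive_comp[of Suc]) (auto intro: recursiveI[of CSucc])

primrec const_code :: "nat \<Rightarrow> code" where
  "const_code 0 = CZero"
| "const_code (Suc n) = CComp CSucc (const_code n)"

lemma computes_const_code [simp]: "computes (const_code n) x y \<longleftrightarrow> y = n"
  by (induction n arbitrary: y) auto

lemma recursive_const: "recursive (\<lambda>x. c)"
  by (rule recursiveI[of "const_code c"]) simp

text \<open>The nested projections match the input that \<open>CPrec\<close> hands to its step
  program: parameter, counter, previous value.\<close>

lemma recursive_rec_nat:
  assumes "recursive f" "recursive (\<lambda>z. g (pfst z) (pfst (psnd z)) (psnd (psnd z)))" "recursive h"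
  shows "recursive (\<lambda>x. rec_nat (f x) (g x) (h x))"
proof -
  obtain p where p: "\<And>x y. computes p x y \<longleftrightarrow> y = f x" using recursive_code[OF assms(1)] by auto
  obtain q where q: "\<And>x y. computes q x y \<longleftrightarrow> y = g (pfst x) (pfst (psnd x)) (psnd (psnd x))"
    using recursive_code[OF assms(2)] by auto
  obtain r where r: "\<And>x y. computes r x y \<longleftrightarrow> y = h x" using recursive_code[OF assms(3)] by auto
  have *: "computes (CPrec p q) (prod_encode (x, n)) (rec_nat (f x) (g x) n)" for x n
  proof (induction n)
    case 0
    show ?case by (auto intro: computes.prec_0 simp: p)
  next
    case (Suc n)
    show ?case by (rule computes.prec_Suc[OF Suc]) (simp add: q)
  qed
  show ?thesis
    by (rule recursiveI[of "CComp (CPrec p q) (CPair (CPair CFst CSnd) r)"]) (simp add: r *)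
qed

lemma recursive_if_0:
  assumes "recursive f" "recursive g" "recursive h"
  shows "recursive (\<lambda>x. if h x = 0 then f x else g x)"
proof -
  have "rec_nat (f x) (\<lambda>_ _. g x) (h x) = (if h x = 0 then f x else g x)" for x
    by (cases "h x") auto
  moreover have "recursive (\<lambda>x. rec_nat (f x) (\<lambda>_ _. g x) (h x))"
    by (intro recursive_rec_nat assms recursive_comp[OF assms(2)] recursive_pfst recursive_id)
  ultimately show ?thesis by simp
qed

lemma recursive_pred:
  assumes "recursive f"
  shows "recursive (\<lambda>x. f x - Suc 0)"
proof -
  have "rec_nat 0 (\<lambda>n _. n) k = k - Suc 0" for k
    by (cases k) auto
  moreover have "recursive (\<lambda>x. rec_nat 0 (\<lambda>n _. n) (f x))"
    by (intro recursive_rec_nat assms recursive_const recursive_pfst recursive_psnd recursive_id)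
  ultimately show ?thesis by simp
qed

lemma recursive_diff:
  assumes "recursive f" "recursive g"
  shows "recursive (\<lambda>x. f x - g x)"
proof -
  have "rec_nat m (\<lambda>_ y. y - Suc 0) k = m - k" for m k :: nat
    by (induction k) auto
  moreover have "recursive (\<lambda>x. rec_nat (f x) (\<lambda>_ y. y - Suc 0) (g x))"
    by (intro recursive_rec_nat assms recursive_pred recursive_psnd recursive_id)
  ultimately show ?thesis by simp
qed

lemma recursive_if_eq:
  assumes "recursive f" "recursive g" "recursive h" "recursive k"
  shows "recursive (\<lambda>x. if h x = k x then f x else g x)"
proof -
  have "recursive (\<lambda>x. if h x - k x = 0 then if k x - h x = 0 then f x else g x else g x)"
    by (intro recursive_if_0 recursive_diff assms)
  moreover have "(\<lambda>x. if h x - k x = 0 then if k x - h x = 0 then f x else g x else g x) =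
      (\<lambda>x. if h x = k x then f x else g x)"
    by auto
  ultimately show ?thesis by simp
qed

lemmas recursive_intros = recursive_id recursive_const recursive_pfst recursive_psnd recursive_pair
  recursive_Suc recursive_pred recursive_diff recursive_if_eq

text \<open>Kleene's second recursion theorem; it needs no universal program here, because the program
  only has to know its own number and never has to run it.\<close>

lemma recursion_theorem:
  "\<exists>r. \<forall>x y. computes r x y \<longleftrightarrow> computes q (prod_encode (code_num r, x)) y"
proof -
  define I where "I = CPair CFst CSnd"
  \<comment> \<open>When n numbers a program, \<open>s n\<close> numbers the program that on input x
    runs program n on the pair (n, x); 5 and 4 are the tags of \<open>CComp\<close> and
    \<open>CPair\<close>.\<close>
  define s where "s n = prod_encode (5, prod_encode (n, prod_encode (4,
    prod_encode (code_num (const_code n), code_num I))))" for n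
  have "code_num (const_code n) = rec_nat (code_num CZero)
      (\<lambda>_ y. prod_encode (5, prod_encode (code_num CSucc, y))) n" for n
    by (induction n) auto
  then have "recursive (\<lambda>n. code_num (const_code n))"
    by (simp only:) (intro recursive_rec_nat recursive_intros)
  then have "recursive s"
    unfolding s_def by (intro recursive_intros)
  then obtain c where c: "\<And>x y. computes c x y \<longleftrightarrow> y = s x"
    using recursive_code by meson
  \<comment> \<open>Diagonalisation: \<open>p\<close> replaces the first component n of its input by
    \<open>s n\<close> and then runs \<open>q\<close>. Fed its own number, it becomes
    \<open>r\<close>, whose number is \<open>s\<close> at the number of \<open>p\<close>.\<close>
  define p where "p = CComp q (CPair (CComp c CFst) CSnd)"
  define r where "r = CComp p (CPair (const_code (code_num p)) I)"
  have s: "s (code_num p) = code_num r"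
    by (simp add: r_def s_def)
  have p: "computes p z y \<longleftrightarrow> computes q (prod_encode (s (pfst z), psnd z)) y" for z y
    by (simp add: p_def c)
  have "computes r x y \<longleftrightarrow> computes p (prod_encode (code_num p, x)) y" for x y
    by (simp add: r_def I_def)
  then show ?thesis using s by (auto simp: p)
qed

text \<open>\<open>CMu\<close> applied to a test that ignores the search variable either stops at
  once with value 0 or diverges. Running it beside a total function makes that function undefined
  where the test fails.\<close>

lemma guarded_code:
  assumes "recursive f" "recursive d"
  shows "\<exists>p. \<forall>x y. computes p x y \<longleftrightarrow> d x = 0 \<and> y = f x"
proof -
  obtain p where p: "\<And>x y. computes p x y \<longleftrightarrow> y = f x" using recursive_code[OF assms(1)] by auto
  have "recursive (\<lambda>z. d (pfst z))"
    by (rule recursive_comp[OF assms(2) recursive_pfst[OF recursive_id]])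
  then obtain q where q: "\<And>x y. computes q x y \<longleftrightarrow> y = d (pfst x)" using recursive_code by meson
  have mu: "computes (CMu q) x y \<longleftrightarrow> d x = 0 \<and> y = 0" for x y
  proof
    assume *: "computes (CMu q) x y"
    then have "computes q (prod_encode (x, y)) 0" by (rule computes_CMuE)
    then have "d x = 0" by (simp add: q)
    then have "computes q (prod_encode (x, 0)) 0" by (simp add: q)
    then have "computes (CMu q) x 0" by (rule computes.mu) simp
    with * \<open>d x = 0\<close> show "d x = 0 \<and> y = 0" using computes_functional by blast
  next
    assume *: "d x = 0 \<and> y = 0"
    then have "computes q (prod_encode (x, 0)) 0" by (simp add: q)
    then have "computes (CMu q) x 0" by (rule computes.mu) simp
    with * show "computes (CMu q) x y" by simp
  qed
  have "computes (CComp p (CComp CFst (CPair (CPair CFst CSnd) (CMu q)))) x y \<longleftrightarrow> d x = 0 \<and> y = f x" for x y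
    by (auto simp: p mu)
  then show ?thesis by blast
qed

section \<open>Semidecidable sets\<close>

definition ce :: "nat set \<Rightarrow> bool" where
  "ce S \<longleftrightarrow> (\<exists>e. W e = S)"

lemma ceI: "(\<And>x. x \<in> S \<longleftrightarrow> (\<exists>y. computes p x y)) \<Longrightarrow> ce S"
  unfolding ce_def W_def by (intro exI[of _ "code_num p"]) (simp add: set_eq_iff)

text \<open>A number that codes no program also indexes the empty set; an element of
  \<open>S\<close> guarantees a program behind the index.\<close>

lemma ceE:
  assumes "ce S" "S \<noteq> {}"
  obtains p where "\<And>x. x \<in> S \<longleftrightarrow> (\<exists>y. computes p x y)"
proof -
  from assms(1) obtain e where e: "W e = S" unfolding ce_def by blast
  with assms(2) obtain p where "code_num p = e" unfolding W_def phi_def by blast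
  with e show ?thesis by (intro that[of p]) (auto simp: W_def)
qed

lemma ce_decidable:
  assumes "recursive d"
  shows "ce {x. d x = 0}"
proof -
  obtain p where "\<And>x y. computes p x y \<longleftrightarrow> d x = 0 \<and> y = x"
    using guarded_code[OF recursive_id assms] by blast
  then show ?thesis by (intro ceI[of _ p]) simp
qed

lemma ce_empty: "ce {}"
  using ce_decidable[OF recursive_const[of 1]] by simp

lemma ce_singleton: "ce {n}"
proof -
  have "ce {x. (if x = n then 0 else 1) = (0 :: nat)}"
    by (intro ce_decidable recursive_intros)
  also have "{x. (if x = n then 0 else 1) = (0 :: nat)} = {n}" by auto
  finally show ?thesis .
qed

lemma ce_vimage_Int:
  assumes "ce S" "ce T" "recursive f" "recursive g"
  shows "ce {x. f x \<in> S \<and> g x \<in> T}"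
proof (cases "S = {} \<or> T = {}")
  case True
  then show ?thesis using ce_empty by auto
next
  case False
  obtain p where p: "\<And>x y. computes p x y \<longleftrightarrow> y = f x" using recursive_code[OF assms(3)] by auto
  obtain q where q: "\<And>x y. computes q x y \<longleftrightarrow> y = g x" using recursive_code[OF assms(4)] by auto
  obtain s where s: "\<And>x. x \<in> S \<longleftrightarrow> (\<exists>y. computes s x y)" using ceE assms(1) False by blast
  obtain t where t: "\<And>x. x \<in> T \<longleftrightarrow> (\<exists>y. computes t x y)" using ceE assms(2) False by blast
  show ?thesis
    by (rule ceI[of _ "CPair (CComp s p) (CComp t q)"])
      (auto simp: p q s t)
qed

lemma ce_vimage: "ce S \<Longrightarrow> recursive f \<Longrightarrow> ce {x. f x \<in> S}"
  using ce_vimage_Int[of S S f f] by simp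

text \<open>Primitive recursion evaluates both branches of a case distinction. The branch that is not
  taken is therefore run on a fixed element of its set, where it terminates.\<close>

lemma ce_if:
  assumes "ce S" "ce T" "recursive d"
  shows "ce {x. if d x = 0 then x \<in> S else x \<in> T}"
proof -
  have "recursive (\<lambda>x. if d x = 0 then 1 else 0)"
    using assms(3) by (intro recursive_if_0 recursive_intros)
  with assms(3) have dec: "ce {x. d x = 0}" "ce {x. (if d x = 0 then 1 else 0) = (0 :: nat)}"
    by (auto simp only: intro: ce_decidable)
  consider "S = {}" | "T = {}" | s t where "s \<in> S" "t \<in> T" by blast
  then show ?thesis
  proof cases
    case 1
    then have eq: "{x. if d x = 0 then x \<in> S else x \<in> T} =
        {x. x \<in> T \<and> x \<in> {x. (if d x = 0 then 1 else 0) = (0 :: nat)}}"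
      by auto
    show ?thesis
      unfolding eq by (rule ce_vimage_Int[OF assms(2) dec(2) recursive_id recursive_id])
  next
    case 2
    then have eq: "{x. if d x = 0 then x \<in> S else x \<in> T} = {x. x \<in> S \<and> x \<in> {x. d x = 0}}"
      by auto
    show ?thesis
      unfolding eq by (rule ce_vimage_Int[OF assms(1) dec(1) recursive_id recursive_id])
  next
    case (3 s t)
    have "ce {x. (if d x = 0 then x else s) \<in> S \<and> (if d x = 0 then t else x) \<in> T}"
      using assms by (intro ce_vimage_Int recursive_if_0 recursive_intros)
    also have "{x. (if d x = 0 then x else s) \<in> S \<and> (if d x = 0 then t else x) \<in> T} =
        {x. if d x = 0 then x \<in> S else x \<in> T}"
      using 3 by auto
    finally show ?thesis .
  qed
qed

section \<open>Course-of-values recursion\<close>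

primrec hist :: "(nat \<Rightarrow> nat) \<Rightarrow> nat \<Rightarrow> nat" where
  "hist G 0 = 0"
| "hist G (Suc n) = Suc (prod_encode (G (prod_encode (n, hist G n)), hist G n))"

text \<open>Course-of-values recursion: \<open>G\<close> receives \<open>n\<close> and the list of the values below \<open>n\<close>, latest first.\<close>

definition cov :: "(nat \<Rightarrow> nat) \<Rightarrow> nat \<Rightarrow> nat" where
  "cov G n = G (prod_encode (n, hist G n))"

text \<open>In the history below n the value at m stands behind the \<open>n - Suc m\<close> later
  ones, so that many tails are taken before the head. Subtracting 1 removes the \<open>Suc\<close>
  that marks a nonempty list code. The result is meaningful for m < n.\<close>

definition prev :: "nat \<Rightarrow> nat \<Rightarrow> nat \<Rightarrow> nat" where
  "prev n h m = pfst (rec_nat h (\<lambda>_ y. psnd (y - Suc 0)) (n - Suc m) - Suc 0)"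

lemma prev_hist:
  assumes "m < n"
  shows "prev n (hist G n) m = cov G m"
proof -
  have "rec_nat (hist G (j + Suc m)) (\<lambda>_ y. psnd (y - Suc 0)) j = hist G (Suc m)" for j
  proof (induction j)
    case (Suc j)
    \<comment> \<open>\<open>rec_nat\<close> adds the new tail outermost, whereas the extra entry of
      the longer history has to go first; the iterates commute.\<close>
    have shift: "rec_nat (psnd (y - Suc 0)) (\<lambda>_ y. psnd (y - Suc 0)) j =
        psnd (rec_nat y (\<lambda>_ y. psnd (y - Suc 0)) j - Suc 0)" for y
      by (induction j) auto
    from Suc show ?case
      by (simp add: shift[symmetric])
  qed simp
  from this[of "n - Suc m"] assms show ?thesis
    by (simp add: prev_def cov_def)
qed

lemma recursive_cov:
  assumes "recursive G"
  shows "recursive (cov G)"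
proof -
  have eq: "hist G n = rec_nat 0 (\<lambda>n h. Suc (prod_encode (G (prod_encode (n, h)), h))) n" for n
    by (induction n) auto
  have "recursive (hist G)"
    unfolding eq
    by (intro recursive_rec_nat recursive_intros recursive_comp[OF assms])
  then show ?thesis
    unfolding cov_def by (intro recursive_intros recursive_comp[OF assms]) 
qed

lemma recursive_prev:
  assumes "recursive f" "recursive g" "recursive h"
  shows "recursive (\<lambda>x. prev (f x) (g x) (h x))"
  unfolding prev_def by (intro recursive_intros recursive_rec_nat assms)

lemma recursive_map_list:
  assumes "recursive f"
  shows "recursive (\<lambda>n. list_encode (map f (list_decode n)))"
proof -
  define G where "G z = (if pfst z = 0 then 0 else Suc (prod_encode (f (pfst (pfst z - Suc 0)),
    prev (pfst z) (psnd z) (psnd (pfst z - Suc 0)))))" for z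
  have "recursive G"
    unfolding G_def by (intro recursive_intros recursive_prev recursive_comp[OF assms])
  have cov: "cov G n = (if n = 0 then 0 else Suc (prod_encode (f (pfst (n - Suc 0)),
    prev n (hist G n) (psnd (n - Suc 0)))))" for n
    by (simp add: cov_def G_def)
  have "cov G (list_encode xs) = list_encode (map f xs)" for xs
  proof (induction xs)
    case (Cons x xs)
    have "list_encode xs < list_encode (x # xs)"
      by (simp add: le_imp_less_Suc le_prod_encode_2)
    from prev_hist[OF this] Cons show ?case
      by (simp add: cov[of "Suc (prod_encode (x, list_encode xs))"] del: hist.simps)
  qed (simp add: cov)
  from this[of "list_decode _"] have "cov G = (\<lambda>n. list_encode (map f (list_decode n)))"
    by (simp add: fun_eq_iff)
  with recursive_cov[OF \<open>recursive G\<close>] show ?thesis by simp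
qed

section \<open>Renaming variables in quantifier-free formulas\<close>

primrec ren_trm :: "(nat \<Rightarrow> nat) \<Rightarrow> trm \<Rightarrow> trm" where
  "ren_trm t (Var x) = Var (t x)"
| "ren_trm t (App f ts) = App f (map (ren_trm t) ts)"

primrec ren_form :: "(nat \<Rightarrow> nat) \<Rightarrow> form \<Rightarrow> form" where
  "ren_form t (Eq u v) = Eq (ren_trm t u) (ren_trm t v)"
| "ren_form t (Rel r ts) = Rel r (map (ren_trm t) ts)"
| "ren_form t (Neg \<phi>) = Neg (ren_form t \<phi>)"
| "ren_form t (And \<phi> \<psi>) = And (ren_form t \<phi>) (ren_form t \<psi>)"
| "ren_form t (Or \<phi> \<psi>) = Or (ren_form t \<phi>) (ren_form t \<psi>)"
| "ren_form t (Conj I \<Phi>) = Conj I (\<lambda>i. ren_form t (\<Phi> i))"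
| "ren_form t (Disj I \<Phi>) = Disj I (\<lambda>i. ren_form t (\<Phi> i))"
| "ren_form t (Ex x \<phi>) = Ex (t x) (ren_form t \<phi>)"
| "ren_form t (All x \<phi>) = All (t x) (ren_form t \<phi>)"

lemma tm_val_ren: "tm_val A s (ren_trm t u) = tm_val A (s \<circ> t) u"
  by (induction u) (auto intro: arg_cong[where f = "fun_int A _"])

lemma tm_vars_ren: "tm_vars (ren_trm t u) = t ` tm_vars u"
  by (induction u) auto

lemma wf_trm_ren: "wf_trm L u \<Longrightarrow> wf_trm L (ren_trm t u)"
  by (induction u) auto

lemma ren_trm_inverse: "(\<And>x. t' (t x) = x) \<Longrightarrow> ren_trm t' (ren_trm t u) = u"
  by (induction u) (auto simp: map_idI)

lemma sat_ren: "finitary_qf \<phi> \<Longrightarrow> sat A (ren_form t \<phi>) s \<longleftrightarrow> sat A \<phi> (s \<circ> t)"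
  by (induction rule: finitary_qf.induct)
    (auto simp: tm_val_ren comp_def intro!: arg_cong[where f = "rel_int A _"])

lemma free_vars_ren: "finitary_qf \<phi> \<Longrightarrow> free_vars (ren_form t \<phi>) = t ` free_vars \<phi>"
  by (induction rule: finitary_qf.induct) (auto simp: tm_vars_ren image_Un)

lemma wf_form_ren: "finitary_qf \<phi> \<Longrightarrow> wf_form L \<phi> \<Longrightarrow> wf_form L (ren_form t \<phi>)"
  by (induction rule: finitary_qf.induct) (auto simp: wf_trm_ren)

lemma finitary_qf_ren: "finitary_qf \<phi> \<Longrightarrow> finitary_qf (ren_form t \<phi>)"
  by (induction rule: finitary_qf.induct) (auto intro: finitary_qf.intros)

lemma ren_form_inverse:
  "finitary_qf \<phi> \<Longrightarrow> (\<And>x. t' (t x) = x) \<Longrightarrow> ren_form t' (ren_form t \<phi>) = \<phi>"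
  by (induction rule: finitary_qf.induct) (auto simp: ren_trm_inverse map_idI)

text \<open>A code with a nonzero constructor tag exceeds its argument, which makes the look-ups for
  subterms and subformulas legitimate in course-of-values recursion. The constructors with tag 0
  need no look-up.\<close>

lemma less_prod_encode_2:
  assumes "k > 0"
  shows "m < prod_encode (k, m)"
proof -
  have "n \<le> triangle n" for n
    by (induction n) auto
  from this[of "k + m"] assms show ?thesis
    by (simp add: prod_encode_def)
qed

text \<open>Terms and lists of terms are mutually recursive. One course-of-values recursion
  therefore returns a pair: what n becomes when read as the code of a term, and what it becomes when
  read as the code of a list of terms.\<close>

lemma ren_tm_num:
  assumes "recursive t"
  shows "\<exists>f g. recursive f \<and> recursive g \<and> (\<forall>u. f (tm_num u) = tm_num (ren_trm t u)) \<and>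
    (\<forall>us. g (list_encode (map tm_num us)) = list_encode (map tm_num (map (ren_trm t) us)))"
proof -
  define G where "G z = prod_encode
    (if pfst (pfst z) = 0 then prod_encode (0, t (psnd (pfst z)))
     else prod_encode (1, prod_encode (pfst (psnd (pfst z)),
       psnd (prev (pfst z) (psnd z) (psnd (psnd (pfst z)))))),
     if pfst z = 0 then 0
     else Suc (prod_encode (pfst (prev (pfst z) (psnd z) (pfst (pfst z - Suc 0))),
       psnd (prev (pfst z) (psnd z) (psnd (pfst z - Suc 0))))))" for z
  have "recursive G"
    unfolding G_def by (intro recursive_intros recursive_prev recursive_comp[OF assms])
  then have rec: "recursive (cov G)" by (rule recursive_cov)
  have cov: "cov G n = prod_encode
    (if pfst n = 0 then prod_encode (0, t (psnd n))
     else prod_encode (1, prod_encode (pfst (psnd n), psnd (prev n (hist G n) (psnd (psnd n))))),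
     if n = 0 then 0
     else Suc (prod_encode (pfst (prev n (hist G n) (pfst (n - Suc 0))),
       psnd (prev n (hist G n) (psnd (n - Suc 0))))))" for n
    by (simp add: cov_def G_def)
  have cov_App: "pfst (cov G (prod_encode (1, prod_encode (f, l)))) =
      prod_encode (1, prod_encode (f, psnd (cov G l)))" for f l
  proof -
    have "prod_encode (f, l) < prod_encode (1, prod_encode (f, l))"
      by (rule less_prod_encode_2) simp
    then have "l < prod_encode (1, prod_encode (f, l))"
      using le_prod_encode_2[of l f] by simp
    from prev_hist[OF this] show ?thesis
      by (simp add: cov[of "prod_encode (1, prod_encode (f, l))"] del: One_nat_def)
  qed
  have Cons: "psnd (cov G (Suc (prod_encode (x, l)))) = Suc (prod_encode (pfst (cov G x), psnd (cov G l)))" for x l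
  proof -
    have "x < Suc (prod_encode (x, l))" "l < Suc (prod_encode (x, l))"
      by (auto simp: le_imp_less_Suc le_prod_encode_1 le_prod_encode_2)
    from this[THEN prev_hist] show ?thesis
      by (simp add: cov[of "Suc (prod_encode (x, l))"] del: hist.simps)
  qed
  have Nil: "psnd (cov G 0) = 0"
    by (simp add: cov)
  have list: "psnd (cov G (list_encode (map tm_num us))) = list_encode (map tm_num (map (ren_trm t) us))"
    if "\<forall>u\<in>set us. pfst (cov G (tm_num u)) = tm_num (ren_trm t u)" for us
    using that by (induction us) (simp_all add: Nil Cons)
  have trm: "pfst (cov G (tm_num u)) = tm_num (ren_trm t u)" for u
  proof (induction u)
    case (Var x)
    show ?case by (simp add: cov)
  next
    case (App f us)
    with list[of us] show ?case by (simp add: cov_App del: One_nat_def)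
  qed
  show ?thesis
    using trm list recursive_pfst[OF rec] recursive_psnd[OF rec]
    by (intro exI[of _ "\<lambda>x. pfst (cov G x)"] exI[of _ "\<lambda>x. psnd (cov G x)"]) auto
qed

lemma ren_form_num:
  assumes "recursive t"
  shows "\<exists>f. recursive f \<and> (\<forall>\<phi>. finitary_qf \<phi> \<longrightarrow> f (form_num \<phi>) = form_num (ren_form t \<phi>))"
proof -
  obtain f g where f: "recursive f" "\<And>u. f (tm_num u) = tm_num (ren_trm t u)"
    and g: "recursive g"
      "\<And>us. g (list_encode (map tm_num us)) = list_encode (map tm_num (map (ren_trm t) us))"
    using ren_tm_num[OF assms] by blast
  define G where "G z =
    (if pfst (pfst z) = 0 then
       prod_encode (0, prod_encode (f (pfst (psnd (pfst z))), f (psnd (psnd (pfst z)))))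
     else if pfst (pfst z) = 1 then
       prod_encode (1, prod_encode (pfst (psnd (pfst z)), g (psnd (psnd (pfst z)))))
     else if pfst (pfst z) = 2 then
       prod_encode (2, prev (pfst z) (psnd z) (psnd (pfst z)))
     else prod_encode (pfst (pfst z),
       prod_encode (prev (pfst z) (psnd z) (pfst (psnd (pfst z))),
         prev (pfst z) (psnd z) (psnd (psnd (pfst z))))))" for z
  have "recursive G"
    unfolding G_def
    by (intro recursive_intros recursive_prev recursive_comp[OF f(1)] recursive_comp[OF g(1)])
  then have rec: "recursive (cov G)" by (rule recursive_cov)
  have cov: "cov G n =
    (if pfst n = 0 then prod_encode (0, prod_encode (f (pfst (psnd n)), f (psnd (psnd n))))
     else if pfst n = 1 then prod_encode (1, prod_encode (pfst (psnd n), g (psnd (psnd n))))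
     else if pfst n = 2 then prod_encode (2, prev n (hist G n) (psnd n))
     else prod_encode (pfst n, prod_encode (prev n (hist G n) (pfst (psnd n)),
       prev n (hist G n) (psnd (psnd n)))))" for n
    by (simp add: cov_def G_def)
  have Neg: "cov G (prod_encode (2, m)) = prod_encode (2, cov G m)" for m
    using prev_hist[OF less_prod_encode_2[of 2 m]]
    by (simp add: cov[of "prod_encode (2, m)"])
  have Bin: "cov G (prod_encode (k, prod_encode (l, m))) = prod_encode (k, prod_encode (cov G l, cov G m))"
    if "k > 2" for k l m
  proof -
    have "prod_encode (l, m) < prod_encode (k, prod_encode (l, m))"
      using that by (intro less_prod_encode_2) simp
    then have "l < prod_encode (k, prod_encode (l, m))" "m < prod_encode (k, prod_encode (l, m))"
      using le_prod_encode_1[of l m] le_prod_encode_2[of m l] by simp_all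
    from this[THEN prev_hist] that show ?thesis
      by (simp add: cov[of "prod_encode (k, prod_encode (l, m))"])
  qed
  have "cov G (form_num \<phi>) = form_num (ren_form t \<phi>)" if "finitary_qf \<phi>" for \<phi>
    using that
  proof (induction rule: finitary_qf.induct)
    case (1 u v)
    show ?case by (simp add: cov f)
  next
    case (2 r ts)
    show ?case by (simp add: cov g)
  qed (simp_all add: Neg Bin)
  with rec show ?thesis by blast
qed

section \<open>Ordinal notations\<close>

lemma in_O_not_0: "in_O a \<Longrightarrow> a \<noteq> 0"
  by (auto elim: in_O.cases)

lemma less_O_in_O: "less_O a b \<Longrightarrow> in_O a \<and> in_O b"
proof (induction rule: in_O_less_O.inducts(2)[where ?P1.0 = "\<lambda>_. True"])
  case (less_O_lim e f k)
  then show ?case using in_O_lim by blast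
qed (auto intro: in_O_less_O.intros)

lemma two_power_neq_limit: "2 ^ a = (3 * 5 ^ e :: nat) \<Longrightarrow> False"
proof -
  assume eq: "2 ^ a = (3 * 5 ^ e :: nat)"
  then have "odd (2 ^ a :: nat)" by simp
  then have "a = 0" by (cases a) auto
  with eq show False by simp
qed

lemma less_O_succD: "less_O x y \<Longrightarrow> y = 2 ^ b \<Longrightarrow> x = b \<or> less_O x b"
proof (induction arbitrary: b rule: in_O_less_O.inducts(2)[where ?P1.0 = "\<lambda>_. True"])
  case (less_O_lim e f k)
  then show ?case using two_power_neq_limit by metis
next
  case (less_O_trans a c d)
  then show ?case using in_O_less_O.less_O_trans by blast
qed (auto intro: in_O_less_O.intros)

lemma less_O_limD:
  assumes "less_O x y" "y = 3 * 5 ^ e" "\<And>n. phi e n (f n)"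
  shows "\<exists>k. x = f k \<or> less_O x (f k)"
  using assms
proof (induction rule: in_O_less_O.inducts(2)[where ?P1.0 = "\<lambda>_. True"])
  case (less_O_succ a)
  then show ?case using two_power_neq_limit by metis
next
  case (less_O_lim e' f' k)
  then have "e' = e" by simp
  then have "f' k = f k" using less_O_lim(1)[of k] less_O_lim.prems(2)[of k] phi_functional by blast
  then show ?case by blast
next
  case (less_O_trans a c d)
  then show ?case using in_O_less_O.less_O_trans by blast
qed auto

text \<open>1 is \<open>2 ^ 0\<close>, so a notation below it would be 0 or below 0, but 0 is no
  notation.\<close>

lemma not_less_O_1: "\<not> less_O x 1"
proof
  assume "less_O x 1"
  then show False
    using less_O_succD[of x 1 0] less_O_in_O in_O_not_0 by fastforce
qed

lemma one_less_O: "in_O a \<Longrightarrow> a = 1 \<or> less_O 1 a"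
proof (induction rule: in_O_less_O.inducts(1)[where ?P2.0 = "\<lambda>_ _. True"])
  case (in_O_succ a)
  then show ?case using in_O_less_O.less_O_succ in_O_less_O.less_O_trans by metis
next
  case (in_O_lim e f)
  then show ?case using less_O_lim less_O_trans by metis
qed auto

lemma succ_le_O: "less_O x b \<Longrightarrow> 2 ^ x = b \<or> less_O (2 ^ x) b"
proof (induction rule: in_O_less_O.inducts(2)[where ?P1.0 = "\<lambda>_. True"])
  case (less_O_lim e f k)
  have "less_O (f (Suc k)) (3 * 5 ^ e)"
    using less_O_lim by (intro in_O_less_O.less_O_lim) auto
  then show ?case using less_O_lim(5)[of k] in_O_less_O.less_O_trans by metis
next
  case (less_O_trans a b c)
  then show ?case using in_O_less_O.less_O_trans by metis
qed auto

text \<open>The order on all notations is a tree, so comparability needs a common bound. At a limit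
  both notations are brought to or below a single term of the fundamental sequence.\<close>

lemma less_O_linear:
  "in_O a \<Longrightarrow> less_O x a \<Longrightarrow> less_O y a \<Longrightarrow> x = y \<or> less_O x y \<or> less_O y x"
proof (induction arbitrary: x y rule: in_O_less_O.inducts(1)[where ?P2.0 = "\<lambda>_ _. True"])
  case in_O_zero
  then show ?case using not_less_O_1 by blast
next
  case (in_O_succ a)
  then show ?case using less_O_succD by blast
next
  case (in_O_lim e f)
  have mono: "f m = f n \<or> less_O (f m) (f n)" if "m \<le> n" for m n
    using that
  proof (induction n rule: dec_induct)
    case (step n)
    then show ?case using in_O_lim less_O_trans by metis
  qed simp
  obtain k where k: "x = f k \<or> less_O x (f k)" using less_O_limD in_O_lim by blast
  obtain l where l: "y = f l \<or> less_O y (f l)" using less_O_limD in_O_lim by blast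
  have "x = f (max k l) \<or> less_O x (f (max k l))" "y = f (max k l) \<or> less_O y (f (max k l))"
    using k l mono[of k "max k l"] mono[of l "max k l"] less_O_trans by (metis max.cobounded1 max.cobounded2)+
  then show ?case using in_O_lim by metis
qed auto

lemma Field_ord_O: "Field (ord_O a) = {b. less_O b a}"
  by (auto simp: Field_def ord_O_def)

text \<open>The embedded two-element order yields two different notations below \<open>a\<close>.
  One of them is not 1, hence lies above 1, so 2 = \<open>2 ^ 1\<close>, the notation of the ordinal
  1, is at most that one.\<close>

lemma two_less_O:
  assumes "natLeq_on 2 \<le>o ord_O a"
  shows "less_O 2 a"
proof -
  from assms obtain f where "Well_order (natLeq_on 2)" "embed (natLeq_on 2) (ord_O a) f"
    unfolding ordLeq_def by blast
  then have inj: "inj_on f (Field (natLeq_on 2))" and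
    into: "f ` Field (natLeq_on 2) \<subseteq> Field (ord_O a)"
    using embed_inj_on embed_Field by blast+
  have "0 \<in> Field (natLeq_on 2)" "1 \<in> Field (natLeq_on 2)"
    by (auto simp: Field_natLeq_on)
  with inj into have "f 0 \<noteq> f 1" "less_O (f 0) a" "less_O (f 1) a"
    by (auto simp: Field_ord_O inj_on_def)
  then obtain b where "b \<noteq> 1" "less_O b a" by metis
  then have "less_O 1 b" using one_less_O less_O_in_O by blast
  then show ?thesis using succ_le_O[of 1 b] \<open>less_O b a\<close> less_O_trans by force
qed

section \<open>Renaming and finite conjunctions of computable infinitary formulas\<close>

lemma tm_val_cong: "(\<And>x. x \<in> tm_vars t \<Longrightarrow> s x = s' x) \<Longrightarrow> tm_val A s t = tm_val A s' t"
proof (induction t)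
  case (App f ts)
  then have "map (tm_val A s) ts = map (tm_val A s') ts" by (intro map_cong) auto
  then show ?case by (simp only: tm_val.simps)
qed simp

lemma sat_cong: "(\<And>x. x \<in> free_vars \<phi> \<Longrightarrow> s x = s' x) \<Longrightarrow> sat A \<phi> s \<longleftrightarrow> sat A \<phi> s'"
proof (induction \<phi> arbitrary: s s')
  case (Eq t u)
  then have "tm_val A s t = tm_val A s' t" "tm_val A s u = tm_val A s' u"
    by (auto intro!: tm_val_cong)
  then show ?case by simp
next
  case (Rel r ts)
  then have "map (tm_val A s) ts = map (tm_val A s') ts"
    by (intro map_cong tm_val_cong) auto
  then show ?case by (simp only: sat.simps)
next
  case (Neg \<phi>)
  have "sat A \<phi> s \<longleftrightarrow> sat A \<phi> s'"
    using Neg.prems by (intro Neg.IH) auto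
  then show ?case by simp
next
  case (And \<phi> \<psi>)
  have "sat A \<phi> s \<longleftrightarrow> sat A \<phi> s'" "sat A \<psi> s \<longleftrightarrow> sat A \<psi> s'"
    using And.prems by (auto intro!: And.IH)
  then show ?case by simp
next
  case (Or \<phi> \<psi>)
  have "sat A \<phi> s \<longleftrightarrow> sat A \<phi> s'" "sat A \<psi> s \<longleftrightarrow> sat A \<psi> s'"
    using Or.prems by (auto intro!: Or.IH)
  then show ?case by simp
next
  case (Conj I \<Phi>)
  have "sat A (\<Phi> i) s \<longleftrightarrow> sat A (\<Phi> i) s'" if "i \<in> I" for i
    using that Conj.prems by (intro Conj.IH) auto
  then show ?case by simp
next
  case (Disj I \<Phi>)
  have "sat A (\<Phi> i) s \<longleftrightarrow> sat A (\<Phi> i) s'" if "i \<in> I" for i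
    using that Disj.prems by (intro Disj.IH) auto
  then show ?case by simp
next
  case (Ex x \<phi>)
  have "sat A \<phi> (s(x := v)) \<longleftrightarrow> sat A \<phi> (s'(x := v))" for v
    using Ex.prems by (intro Ex.IH) auto
  then show ?case by simp
next
  case (All x \<phi>)
  have "sat A \<phi> (s(x := v)) \<longleftrightarrow> sat A \<phi> (s'(x := v))" for v
    using All.prems by (intro All.IH) auto
  then show ?case by simp
qed

lemma free_vars_Exs [simp]: "free_vars (Exs us \<phi>) = free_vars \<phi> - set us"
  by (induction us) auto

lemma free_vars_Alls [simp]: "free_vars (Alls us \<phi>) = free_vars \<phi> - set us"
  by (induction us) auto

lemma wf_form_Exs [simp]: "wf_form L (Exs us \<phi>) = wf_form L \<phi>"
  by (induction us) auto

lemma wf_form_Alls [simp]: "wf_form L (Alls us \<phi>) = wf_form L \<phi>"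
  by (induction us) auto

lemma sat_Exs:
  "sat A (Exs us \<phi>) s \<longleftrightarrow> (\<exists>s'. (\<forall>x. x \<notin> set us \<longrightarrow> s' x = s x) \<and> sat A \<phi> s')"
proof (induction us arbitrary: s)
  case Nil
  have "s' = s" if "\<forall>x. s' x = s x" for s' using that by auto
  then show ?case by auto
next
  case (Cons u us)
  show ?case
  proof
    assume "sat A (Exs (u # us) \<phi>) s"
    then obtain v s' where "\<forall>x. x \<notin> set us \<longrightarrow> s' x = (s(u := v)) x" "sat A \<phi> s'"
      by (auto simp: Cons)
    then show "\<exists>s'. (\<forall>x. x \<notin> set (u # us) \<longrightarrow> s' x = s x) \<and> sat A \<phi> s'"
      by (intro exI[of _ s']) auto
  next
    assume "\<exists>s'. (\<forall>x. x \<notin> set (u # us) \<longrightarrow> s' x = s x) \<and> sat A \<phi> s'"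
    then obtain s' where "\<forall>x. x \<notin> set (u # us) \<longrightarrow> s' x = s x" "sat A \<phi> s'" by blast
    then have "sat A (Exs us \<phi>) (s(u := s' u))"
      unfolding Cons by (intro exI[of _ s']) auto
    then show "sat A (Exs (u # us) \<phi>) s" by auto
  qed
qed

lemma sat_Alls_Exs: "sat A (Alls us \<phi>) s \<longleftrightarrow> \<not> sat A (Exs us (Neg \<phi>)) s"
  by (induction us arbitrary: s) auto

lemma sat_Alls:
  "sat A (Alls us \<phi>) s \<longleftrightarrow> (\<forall>s'. (\<forall>x. x \<notin> set us \<longrightarrow> s' x = s x) \<longrightarrow> sat A \<phi> s')"
  by (auto simp: sat_Alls_Exs sat_Exs)

lemma has_index_facts:
  "has_index L K a xs i \<phi> \<Longrightarrow> in_O a \<and> distinct xs \<and> free_vars \<phi> \<subseteq> set xs \<and> wf_form L \<phi>"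
proof (induction rule: has_index.induct)
  case (zero \<phi> xs K)
  then show ?case by (auto intro: in_O_zero simp del: One_nat_def)
next
  case (Sigma a xs e b ys \<psi>)
  have "free_vars (Exs (part_vars n) (\<psi> n)) \<subseteq> set xs" if "n \<in> W e" for n
    using Sigma(4,6)[OF that] by auto
  then have "free_vars (Disj (W e) (\<lambda>n. Exs (part_vars n) (\<psi> n))) \<subseteq> set xs"
    unfolding free_vars.simps by blast
  with Sigma show ?case by simp
next
  case (Pi a xs e b ys \<psi>)
  have "free_vars (Alls (part_vars n) (\<psi> n)) \<subseteq> set xs" if "n \<in> W e" for n
    using Pi(4,6)[OF that] by auto
  then have "free_vars (Conj (W e) (\<lambda>n. Alls (part_vars n) (\<psi> n))) \<subseteq> set xs"
    unfolding free_vars.simps by blast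
  with Pi show ?case by simp
qed

lemma has_index_1: "has_index L K 1 xs i \<phi> \<Longrightarrow> finitary_qf \<phi>"
  by (auto elim: has_index.cases)

lemma has_index_in_O: "has_index L K a xs i \<phi> \<Longrightarrow> in_O a"
  and has_index_free_vars: "has_index L K a xs i \<phi> \<Longrightarrow> free_vars \<phi> \<subseteq> set xs"
  and has_index_wf_form: "has_index L K a xs i \<phi> \<Longrightarrow> wf_form L \<phi>"
  using has_index_facts[of L K a xs i \<phi>] by simp_all

text \<open>Bound variables are renamed along with the free ones. Injectivity rules out capture:
  changing \<open>s\<close> at \<open>t u\<close> alters \<open>s \<circ> t\<close> at
  \<open>u\<close> only.\<close>

lemma sat_Exs_rename:
  assumes "inj t" "\<And>s. sat A \<psi>' s \<longleftrightarrow> sat A \<psi> (s \<circ> t)"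
  shows "sat A (Exs (map t us) \<psi>') s \<longleftrightarrow> sat A (Exs us \<psi>) (s \<circ> t)"
proof (induction us arbitrary: s)
  case (Cons u us)
  have eq: "s(t u := v) \<circ> t = (s \<circ> t)(u := v)" for s :: "nat \<Rightarrow> nat" and v
    using assms(1) by (auto simp: inj_eq)
  have "Exs (x # xs) \<phi> = Ex x (Exs xs \<phi>)" for x xs \<phi> by simp
  then show ?case by (simp only: list.map sat.simps Cons eq)
qed (simp add: assms)

lemma sat_Alls_rename:
  assumes "inj t" "\<And>s. sat A \<psi>' s \<longleftrightarrow> sat A \<psi> (s \<circ> t)"
  shows "sat A (Alls (map t us) \<psi>') s \<longleftrightarrow> sat A (Alls us \<psi>) (s \<circ> t)"
  unfolding sat_Alls_Exs using sat_Exs_rename[OF assms(1), of A "Neg \<psi>'" "Neg \<psi>" us s] assms(2)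
  by simp

text \<open>The c.e. set of a renamed index is the image of the original one under the renaming itself,
  so the renaming is defined by the recursion theorem. Membership in the image is semidecidable
  because the renaming has a computable left inverse \<open>Q2\<close>.\<close>

lemma rename_index:
  assumes t: "recursive t" and t': "recursive t'" and inv: "\<And>x. t' (t x) = x"
  shows "\<exists>R. \<forall>L K b ys i \<psi>. has_index L K b ys i \<psi> \<longrightarrow>
    (\<exists>\<psi>'. has_index L K b (map t ys) (R i) \<psi>' \<and> (\<forall>A s. sat A \<psi>' s \<longleftrightarrow> sat A \<psi> (s \<circ> t)))"
proof -
  obtain f where f: "recursive f" "\<And>\<phi>. finitary_qf \<phi> \<Longrightarrow> f (form_num \<phi>) = form_num (ren_form t \<phi>)"
    using ren_form_num[OF t] by blast
  obtain f' where f': "recursive f'" "\<And>\<phi>. finitary_qf \<phi> \<Longrightarrow> f' (form_num \<phi>) = form_num (ren_form t' \<phi>)"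
    using ren_form_num[OF t'] by blast
  define m where "m n = list_encode (map t (list_decode n))" for n
  define m' where "m' n = list_encode (map t' (list_decode n))" for n
  have m: "recursive m" "recursive m'"
    unfolding m_def m'_def using recursive_map_list[OF t] recursive_map_list[OF t'] by auto
  have m'm: "m' (m n) = n" for n
    by (simp add: m_def m'_def inv comp_def)
  \<comment> \<open>Above level 0 the c.e. index e becomes the number of the composition of program
    e after program k (5 is the tag of \<open>CComp\<close>). Program k has to send a renamed part
    back to the original, so it must invert \<open>R2 k\<close>, which itself mentions k.\<close>
  define R where "R k i = prod_encode (pfst i, prod_encode (pfst (psnd i), prod_encode
    (m (pfst (psnd (psnd i))), if pfst (psnd i) = 1 then f (psnd (psnd (psnd i)))
      else prod_encode (5, prod_encode (psnd (psnd (psnd i)), k)))))" for k i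
  \<comment> \<open>The original e is read off from the composition, so this inverse does not depend
    on k.\<close>
  define Q where "Q i = prod_encode (pfst i, prod_encode (pfst (psnd i), prod_encode
    (m' (pfst (psnd (psnd i))), if pfst (psnd i) = 1 then f' (psnd (psnd (psnd i)))
      else pfst (psnd (psnd (psnd (psnd i)))))))" for i
  define R2 where "R2 k n = prod_encode (R k (pfst n), m (psnd n))" for k n
  define Q2 where "Q2 n = prod_encode (Q (pfst n), m' (psnd n))" for n
  have recQ: "recursive (\<lambda>x. Q2 (u x))" if "recursive u" for u
    unfolding Q2_def Q_def
    by (intro recursive_intros recursive_comp[OF f'(1)] recursive_comp[OF m(2)] that)
  have recR: "recursive (\<lambda>x. R2 (v x) (u x))" if "recursive u" "recursive v" for u v
    unfolding R2_def R_def
    by (intro recursive_intros recursive_comp[OF f(1)] recursive_comp[OF m(1)] that)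
  have rec: "recursive (\<lambda>z. Q2 (psnd z))"
    "recursive (\<lambda>z. if R2 (pfst z) (Q2 (psnd z)) = psnd z then 0 else 1)"
    by (intro recQ recR recursive_intros)+
  \<comment> \<open>Given k as data, \<open>q\<close> accepts n exactly when renaming the candidate
    preimage \<open>Q2 n\<close> gives n back, and then returns that preimage.\<close>
  obtain q where q: "\<And>z y. computes q z y \<longleftrightarrow>
      (if R2 (pfst z) (Q2 (psnd z)) = psnd z then 0 else 1) = (0::nat) \<and> y = Q2 (psnd z)"
    using guarded_code[OF rec] by blast
  obtain r where r: "\<And>x y. computes r x y \<longleftrightarrow> computes q (prod_encode (code_num r, x)) y"
    using recursion_theorem[of q] by blast
  define k where "k = code_num r"
  define g where "g e = prod_encode (5, prod_encode (e, k))" for e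
  have "phi k n y \<longleftrightarrow> R2 k (Q2 n) = n \<and> y = Q2 n" for n y
    unfolding k_def by (simp add: r) (simp add: q)
  then have W: "n \<in> W (g e) \<longleftrightarrow> R2 k (Q2 n) = n \<and> Q2 n \<in> W e" for n e
    unfolding W_def g_def by (auto simp: phi_comp)
  have R_index: "R k (index K b ys e) = index K b (map t ys) (if b = 1 then f e else g e)" for K b ys e
    by (simp add: R_def index_def m_def g_def)
  \<comment> \<open>Restricted to genuine indices, because \<open>f'\<close> is known to undo
    \<open>f\<close> only on numbers of finitary formulas.\<close>
  have "Q (R k i) = i" if "has_index L K b ys i \<psi>" for L K b ys i \<psi>
    using that
  proof cases
    case zero
    then show ?thesis
      by (simp add: R_index) (simp add: index_def Q_def m'_def f f' finitary_qf_ren ren_form_inverse inv comp_def)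
  qed (simp_all add: R_index, simp_all add: index_def Q_def m'_def inv comp_def g_def)
  then have Q2_R2: "Q2 (R2 k n) = n" if "has_index L K b ys (part_index n) \<psi>" for L K b ys n \<psi>
    using that by (simp add: Q2_def R2_def m'm part_index_def)
  have R2_parts: "part_index (R2 k n) = R k (part_index n)" "part_vars (R2 k n) = map t (part_vars n)" for n
    by (simp_all add: part_index_def part_vars_def R2_def m_def)
  have inj: "inj t" using inv by (metis injI)
  then have inj_on: "inj_on t X" for X by (rule inj_on_subset) simp
  have "\<exists>\<psi>'. has_index L K b (map t ys) (R k i) \<psi>' \<and> (\<forall>A s. sat A \<psi>' s \<longleftrightarrow> sat A \<psi> (s \<circ> t))"
    if "has_index L K b ys i \<psi>" for L K b ys i \<psi>
    using that
  proof (induction rule: has_index.induct)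
    case (zero \<phi> xs K)
    have "has_index L K 1 (map t xs) (index K 1 (map t xs) (form_num (ren_form t \<phi>))) (ren_form t \<phi>)"
      using zero inj
      by (intro has_index.zero)
        (auto simp: finitary_qf_ren wf_form_ren free_vars_ren distinct_map inj_on)
    then show ?case
      using zero(1) by (intro exI[of _ "ren_form t \<phi>"]) (simp add: R_index f sat_ren comp_def)
  next
    case (Sigma a xs e b ys \<psi>)
    then obtain \<psi>' where \<psi>': "\<And>n. n \<in> W e \<Longrightarrow> has_index L PiK (b n) (map t (ys n)) (R k (part_index n)) (\<psi>' n)"
        "\<And>n A s. n \<in> W e \<Longrightarrow> sat A (\<psi>' n) s \<longleftrightarrow> sat A (\<psi> n) (s \<circ> t)"
      by metis
    have parts: "part_index n = R k (part_index (Q2 n)) \<and> part_vars n = map t (part_vars (Q2 n)) \<and> Q2 n \<in> W e"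
      if "n \<in> W (g e)" for n
      using that W R2_parts by metis
    have idx: "has_index L SigmaK a (map t xs) (index SigmaK a (map t xs) (g e))
        (Disj (W (g e)) (\<lambda>n. Exs (part_vars n) (\<psi>' (Q2 n))))"
    proof (rule has_index.Sigma[where b = "\<lambda>n. b (Q2 n)" and ys = "\<lambda>n. map t (ys (Q2 n))"])
      show "less_O (b (Q2 n)) a \<and> set (map t (ys (Q2 n))) \<subseteq> set (map t xs) \<union> set (part_vars n)"
        if "n \<in> W (g e)" for n
        using Sigma(4)[of "Q2 n"] parts[OF that] by auto
    qed (use Sigma \<psi>' parts inj in \<open>auto simp: distinct_map inj_on\<close>)
    have sat: "sat A (Exs (map t us) (\<psi>' n)) s \<longleftrightarrow> sat A (Exs us (\<psi> n)) (s \<circ> t)" if "n \<in> W e" for A n s us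
      using \<psi>'(2)[OF that] by (intro sat_Exs_rename[OF inj])
    have sem: "sat A (Disj (W (g e)) (\<lambda>n. Exs (part_vars n) (\<psi>' (Q2 n)))) s \<longleftrightarrow>
        sat A (Disj (W e) (\<lambda>n. Exs (part_vars n) (\<psi> n))) (s \<circ> t)" for A s
    proof
      assume "sat A (Disj (W e) (\<lambda>n. Exs (part_vars n) (\<psi> n))) (s \<circ> t)"
      then obtain n where n: "n \<in> W e" "sat A (Exs (part_vars n) (\<psi> n)) (s \<circ> t)" by auto
      have "Q2 (R2 k n) = n" using Q2_R2 Sigma(5)[OF n(1)] by blast
      with n sat[OF n(1)] show "sat A (Disj (W (g e)) (\<lambda>n. Exs (part_vars n) (\<psi>' (Q2 n)))) s"
        by (auto simp: W R2_parts intro!: bexI[of _ "R2 k n"])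
    qed (auto simp: sat dest!: parts)
    have "R k (index SigmaK a xs e) = index SigmaK a (map t xs) (g e)"
      using Sigma(2) by (simp add: R_index)
    with idx sem show ?case by metis
  next
    case (Pi a xs e b ys \<psi>)
    then obtain \<psi>' where \<psi>': "\<And>n. n \<in> W e \<Longrightarrow> has_index L SigmaK (b n) (map t (ys n)) (R k (part_index n)) (\<psi>' n)"
        "\<And>n A s. n \<in> W e \<Longrightarrow> sat A (\<psi>' n) s \<longleftrightarrow> sat A (\<psi> n) (s \<circ> t)"
      by metis
    have parts: "part_index n = R k (part_index (Q2 n)) \<and> part_vars n = map t (part_vars (Q2 n)) \<and> Q2 n \<in> W e"
      if "n \<in> W (g e)" for n
      using that W R2_parts by metis
    have idx: "has_index L PiK a (map t xs) (index PiK a (map t xs) (g e))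
        (Conj (W (g e)) (\<lambda>n. Alls (part_vars n) (\<psi>' (Q2 n))))"
    proof (rule has_index.Pi[where b = "\<lambda>n. b (Q2 n)" and ys = "\<lambda>n. map t (ys (Q2 n))"])
      show "less_O (b (Q2 n)) a \<and> set (map t (ys (Q2 n))) \<subseteq> set (map t xs) \<union> set (part_vars n)"
        if "n \<in> W (g e)" for n
        using Pi(4)[of "Q2 n"] parts[OF that] by auto
    qed (use Pi \<psi>' parts inj in \<open>auto simp: distinct_map inj_on\<close>)
    have sat: "sat A (Alls (map t us) (\<psi>' n)) s \<longleftrightarrow> sat A (Alls us (\<psi> n)) (s \<circ> t)" if "n \<in> W e" for A n s us
      using \<psi>'(2)[OF that] by (intro sat_Alls_rename[OF inj])
    have sem: "sat A (Conj (W (g e)) (\<lambda>n. Alls (part_vars n) (\<psi>' (Q2 n)))) s \<longleftrightarrow>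
        sat A (Conj (W e) (\<lambda>n. Alls (part_vars n) (\<psi> n))) (s \<circ> t)" for A s
    proof
      assume *: "sat A (Conj (W (g e)) (\<lambda>n. Alls (part_vars n) (\<psi>' (Q2 n)))) s"
      have "sat A (Alls (part_vars n) (\<psi> n)) (s \<circ> t)" if n: "n \<in> W e" for n
      proof -
        have eq: "Q2 (R2 k n) = n" using Q2_R2 Pi(5)[OF n] by blast
        with n have "R2 k n \<in> W (g e)" by (simp add: W)
        with * have "sat A (Alls (part_vars (R2 k n)) (\<psi>' (Q2 (R2 k n)))) s" by auto
        with sat[OF n] show ?thesis by (simp add: eq R2_parts)
      qed
      then show "sat A (Conj (W e) (\<lambda>n. Alls (part_vars n) (\<psi> n))) (s \<circ> t)" by auto
    qed (auto simp: sat dest!: parts)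
    have "R k (index PiK a xs e) = index PiK a (map t xs) (g e)"
      using Pi(2) by (simp add: R_index)
    with idx sem show ?case by metis
  qed
  then show ?thesis by blast
qed

text \<open>A \<Pi> formula of level \<open>b\<close> taken apart into its c.e. set of conjuncts, so
  that conjunction becomes a union of c.e. sets. The finite list \<open>zs\<close> bounds the free
  variables of all conjuncts; formulas matter only up to satisfaction.\<close>

definition Pi_definable :: "lang \<Rightarrow> nat \<Rightarrow> (struct \<Rightarrow> (nat \<Rightarrow> nat) \<Rightarrow> bool) \<Rightarrow> bool" where
  "Pi_definable L b Q \<longleftrightarrow> (\<exists>S zs c ys \<chi>. ce S \<and>
    (\<forall>n\<in>S. less_O (c n) b \<and> set (ys n) \<subseteq> set zs \<union> set (part_vars n) \<and>
      has_index L SigmaK (c n) (ys n) (part_index n) (\<chi> n)) \<and>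
    (\<forall>A s. Q A s \<longleftrightarrow> (\<forall>n\<in>S. sat A (Alls (part_vars n) (\<chi> n)) s)))"

text \<open>Levels can be raised because conjuncts need only have some level below \<open>b\<close>.
  A finitary formula becomes its own single conjunct, of level 0 and with the empty quantifier
  block, which is coded by 0.\<close>

lemma Pi_definable_sat:
  assumes idx: "has_index L PiK c xs i \<psi>" and b: "c = b \<or> less_O c b" "b \<noteq> 1"
  shows "Pi_definable L b (\<lambda>A. sat A \<psi>)"
  using idx
proof cases
  case zero
  define n where "n = prod_encode (index SigmaK 1 xs (form_num \<psi>), 0)"
  have [simp]: "part_index n = index SigmaK 1 xs (form_num \<psi>)" "part_vars n = []"
    by (simp_all add: n_def part_index_def part_vars_def)
  show ?thesis
    unfolding Pi_definable_def
    by (rule exI[of _ "{n}"], rule exI[of _ xs], rule exI[of _ "\<lambda>_. 1"], rule exI[of _ "\<lambda>_. xs"],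
        rule exI[of _ "\<lambda>_. \<psi>"])
      (use zero b in \<open>auto intro: ce_singleton has_index.zero simp del: One_nat_def\<close>)
next
  case (Pi e c' ys \<chi>)
  have "less_O (c' n) b" if "n \<in> W e" for n
    using Pi(6)[OF that] b less_O_trans by blast
  then show ?thesis
    unfolding Pi_definable_def
    by (intro exI[of _ "W e"] exI[of _ xs] exI[of _ c'] exI[of _ ys] exI[of _ \<chi>])
      (use Pi in \<open>auto simp: ce_def\<close>)
qed

lemma Pi_definable_True: "Pi_definable L b (\<lambda>A s. True)"
  unfolding Pi_definable_def by (intro exI[of _ "{}"]) (auto intro: ce_empty)

lemma sat_Alls_fresh:
  assumes "d \<notin> free_vars (Alls us \<chi>)"
  shows "sat A (Alls (d # us) \<chi>) s \<longleftrightarrow> sat A (Alls us \<chi>) s"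
proof -
  have "sat A (Alls us \<chi>) (s(d := v)) \<longleftrightarrow> sat A (Alls us \<chi>) s" for v
    using assms by (intro sat_cong) auto
  then show ?thesis by simp
qed

text \<open>The union of two c.e. sets is made decidably disjoint by prefixing the quantified tuples with
  a dummy variable, \<open>d\<close> for the first set and \<open>d'\<close> for the second.\<close>

lemma Pi_definable_conj:
  assumes "Pi_definable L b Q" "Pi_definable L b Q'"
  shows "Pi_definable L b (\<lambda>A s. Q A s \<and> Q' A s)"
proof -
  obtain S zs c ys \<chi> where S: "ce S" and
    S1: "\<And>n. n \<in> S \<Longrightarrow> less_O (c n) b \<and> set (ys n) \<subseteq> set zs \<union> set (part_vars n) \<and>
      has_index L SigmaK (c n) (ys n) (part_index n) (\<chi> n)" and
    Q: "\<And>A s. Q A s \<longleftrightarrow> (\<forall>n\<in>S. sat A (Alls (part_vars n) (\<chi> n)) s)"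
    using assms(1) unfolding Pi_definable_def by blast
  obtain S' zs' c' ys' \<chi>' where S': "ce S'" and
    S'1: "\<And>n. n \<in> S' \<Longrightarrow> less_O (c' n) b \<and> set (ys' n) \<subseteq> set zs' \<union> set (part_vars n) \<and>
      has_index L SigmaK (c' n) (ys' n) (part_index n) (\<chi>' n)" and
    Q': "\<And>A s. Q' A s \<longleftrightarrow> (\<forall>n\<in>S'. sat A (Alls (part_vars n) (\<chi>' n)) s)"
    using assms(2) unfolding Pi_definable_def by blast
  \<comment> \<open>A sum bounds its terms, so \<open>d\<close> and \<open>d'\<close> occur in
    neither list. Both are also positive, which matters because the head of an empty tuple reads as
    0.\<close>
  define d where "d = Suc (sum_list (zs @ zs'))"
  define d' where "d' = Suc d"
  have d: "d \<notin> set zs" "d' \<notin> set zs'" "d > 0" "d' > 0" "d \<noteq> d'"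
    using member_le_sum_list[of _ "zs @ zs'"] by (auto simp: d_def d'_def) fastforce+
  define hdc where "hdc n = pfst (psnd n - Suc 0)" for n
  define strip where "strip n = prod_encode (pfst n, psnd (psnd n - Suc 0))" for n
  have rec: "recursive strip" "recursive (\<lambda>n. if hdc n = d then 0 else 1)"
      "recursive (\<lambda>n. if hdc n = d' then 0 else 1)"
    unfolding strip_def hdc_def by (intro recursive_intros)+
  \<comment> \<open>The head of the tuple tells which semidecision procedure to run, so the two
    never have to run in parallel.\<close>
  define U where "U = {n. if (if hdc n = d then 0 else 1 :: nat) = 0 then n \<in> {n. strip n \<in> S}
    else n \<in> {n. strip n \<in> S' \<and> n \<in> {n. (if hdc n = d' then 0 else 1 :: nat) = 0}}}"
  have "ce U"
    unfolding U_def
    by (intro ce_if ce_vimage ce_vimage_Int ce_decidable S S' rec recursive_id)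
  have U: "n \<in> U \<longleftrightarrow> hdc n = d \<and> strip n \<in> S \<or> hdc n = d' \<and> strip n \<in> S'" for n
    using d by (auto simp: U_def)
  have idx: "part_index n = part_index (strip n)" for n
    by (simp add: part_index_def strip_def)
  have vars: "part_vars n = hdc n # part_vars (strip n)" if "hdc n > 0" for n
  proof (cases "psnd n")
    case 0
    have "prod_decode 0 = (0, 0)"
      by (metis prod_encode_inverse list_encode.simps(1) le_prod_encode_1 le_prod_encode_2
          prod_decode_inverse le_zero_eq prod.collapse)
    with 0 that show ?thesis by (simp add: hdc_def)
  next
    case (Suc m)
    then show ?thesis by (simp add: part_vars_def hdc_def strip_def split: prod.split)
  qed
  define join where "join d n = prod_encode (part_index n, list_encode (d # part_vars n))" for d n
  have join: "hdc (join d n) = d" "strip (join d n) = n" "part_vars (join d n) = d # part_vars n" for d n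
    by (simp_all add: hdc_def strip_def join_def part_vars_def part_index_def)
  define X where "X n = (if hdc n = d then \<chi> (strip n) else \<chi>' (strip n))" for n
  have fresh: "sat A (Alls (d # part_vars n) (\<chi> n)) s \<longleftrightarrow> sat A (Alls (part_vars n) (\<chi> n)) s"
    if "n \<in> S" for A n s
    using S1[OF that] d(1) by (intro sat_Alls_fresh) (auto dest: has_index_free_vars)
  have fresh': "sat A (Alls (d' # part_vars n) (\<chi>' n)) s \<longleftrightarrow> sat A (Alls (part_vars n) (\<chi>' n)) s"
    if "n \<in> S'" for A n s
    using S'1[OF that] d(2) by (intro sat_Alls_fresh) (auto dest: has_index_free_vars)
  have sem: "(Q A s \<and> Q' A s) \<longleftrightarrow> (\<forall>n\<in>U. sat A (Alls (part_vars n) (X n)) s)" for A s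
  proof (intro iffI ballI conjI)
    fix n assume "Q A s \<and> Q' A s" "n \<in> U"
    then show "sat A (Alls (part_vars n) (X n)) s"
      using d fresh[of "strip n"] fresh'[of "strip n"] vars[of n]
      unfolding U Q Q' X_def by (auto simp del: foldr.simps)
  next
    assume *: "\<forall>n\<in>U. sat A (Alls (part_vars n) (X n)) s"
    show "Q A s" unfolding Q
    proof
      fix n assume n: "n \<in> S"
      then have "join d n \<in> U" by (simp add: U join)
      with * have "sat A (Alls (part_vars (join d n)) (X (join d n))) s" by blast
      with fresh[OF n] show "sat A (Alls (part_vars n) (\<chi> n)) s"
        by (simp add: join X_def del: foldr.simps)
    qed
    show "Q' A s" unfolding Q'
    proof
      fix n assume n: "n \<in> S'"
      then have "join d' n \<in> U" by (simp add: U join)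
      with * have "sat A (Alls (part_vars (join d' n)) (X (join d' n))) s" by blast
      with fresh'[OF n] d(5) show "sat A (Alls (part_vars n) (\<chi>' n)) s"
        by (simp add: join X_def del: foldr.simps)
    qed
  qed
  define C where "C n = (if hdc n = d then c (strip n) else c' (strip n))" for n
  define Y where "Y n = (if hdc n = d then ys (strip n) else ys' (strip n))" for n
  have "less_O (C n) b \<and> set (Y n) \<subseteq> set (zs @ zs') \<union> set (part_vars n) \<and>
      has_index L SigmaK (C n) (Y n) (part_index n) (X n)" if "n \<in> U" for n
    using that S1[of "strip n"] S'1[of "strip n"] idx[of n] vars[of n] d
    unfolding U C_def Y_def X_def by auto
  with \<open>ce U\<close> sem show ?thesis
    unfolding Pi_definable_def
    by (intro exI[of _ U] exI[of _ "zs @ zs'"] exI[of _ C] exI[of _ Y] exI[of _ X]) simp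
qed

lemma Pi_definable_index:
  assumes "Pi_definable L b Q" "in_O b" "b \<noteq> 1"
  shows "\<exists>zs i \<theta>. has_index L PiK b zs i \<theta> \<and> (\<forall>A s. sat A \<theta> s \<longleftrightarrow> Q A s)"
proof -
  obtain S zs c ys \<chi> where S: "ce S" and
    S1: "\<And>n. n \<in> S \<Longrightarrow> less_O (c n) b \<and> set (ys n) \<subseteq> set zs \<union> set (part_vars n) \<and>
      has_index L SigmaK (c n) (ys n) (part_index n) (\<chi> n)" and
    Q: "\<And>A s. Q A s \<longleftrightarrow> (\<forall>n\<in>S. sat A (Alls (part_vars n) (\<chi> n)) s)"
    using assms(1) unfolding Pi_definable_def by blast
  from S obtain e where e: "W e = S" unfolding ce_def by blast
  have "has_index L PiK b (remdups zs) (index PiK b (remdups zs) e)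
      (Conj (W e) (\<lambda>n. Alls (part_vars n) (\<chi> n)))"
    using S1 assms by (intro has_index.Pi[where b = c and ys = ys]) (auto simp: e)
  then show ?thesis using Q e by (intro exI conjI) auto
qed

lemma finitary_qf_finite_conj:
  assumes "finite G" "\<And>\<psi>. \<psi> \<in> G \<Longrightarrow> finitary_qf \<psi> \<and> wf_form L \<psi>"
  shows "\<exists>\<delta>. finitary_qf \<delta> \<and> wf_form L \<delta> \<and> (\<forall>A s. sat A \<delta> s \<longleftrightarrow> (\<forall>\<psi>\<in>G. sat A \<psi> s))"
  using assms
proof (induction rule: finite_induct)
  case empty
  show ?case by (intro exI[of _ "Eq (Var 0) (Var 0)"]) (auto intro: finitary_qf.intros)
next
  case (insert \<psi> G)
  then obtain \<delta> where "finitary_qf \<delta>" "wf_form L \<delta>" "\<forall>A s. sat A \<delta> s \<longleftrightarrow> (\<forall>\<psi>\<in>G. sat A \<psi> s)"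
    by auto
  with insert show ?case by (intro exI[of _ "And \<psi> \<delta>"]) (auto intro: finitary_qf.intros)
qed

lemma finite_tm_vars: "finite (tm_vars t)"
  by (induction t) auto

lemma finite_free_vars_qf: "finitary_qf \<phi> \<Longrightarrow> finite (free_vars \<phi>)"
  by (induction rule: finitary_qf.induct) (auto simp: finite_tm_vars)

lemma has_index_qf:
  assumes "finitary_qf \<phi>" "wf_form L \<phi>"
  shows "\<exists>xs i. has_index L K 1 xs i \<phi>"
proof -
  obtain xs where "set xs = free_vars \<phi>" "distinct xs"
    using finite_distinct_list[OF finite_free_vars_qf[OF assms(1)]] by blast
  then show ?thesis using has_index.zero[OF assms] by blast
qed

text \<open>Finitely many notations below \<open>a\<close> have a greatest one, so a single level b
  serves for all of \<open>G\<close>. At level 0, that is b = 1, only a finitary conjunction is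
  available; above it the sets of conjuncts are united. The empty conjunction takes b = 1, with
  \<open>2 ^ 1\<close> below \<open>a\<close> by the first assumption.\<close>

lemma finite_conj_Pi:
  assumes "less_O 2 a" "finite G"
    and "\<And>\<psi>. \<psi> \<in> G \<Longrightarrow> \<exists>b ys i. has_index L PiK b ys i \<psi> \<and> less_O (2 ^ b) a"
  shows "\<exists>b zs i \<theta>. has_index L PiK b zs i \<theta> \<and> less_O (2 ^ b) a \<and>
    (\<forall>A s. sat A \<theta> s \<longleftrightarrow> (\<forall>\<psi>\<in>G. sat A \<psi> s))"
proof -
  have below: "less_O b a" if "in_O b" "less_O (2 ^ b) a" for b
    using that less_O_succ less_O_trans by blast
  have a: "in_O a" using assms(1) less_O_in_O by blast
  have "\<exists>b. in_O b \<and> less_O (2 ^ b) a \<and>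
      (\<forall>\<psi>\<in>G. \<exists>c ys i. has_index L PiK c ys i \<psi> \<and> (c = b \<or> less_O c b))"
    using assms(2,3)
  proof (induction rule: finite_induct)
    case empty
    show ?case using assms(1) in_O_zero by (intro exI[of _ 1]) auto
  next
    case (insert \<psi> G)
    then obtain b where b: "in_O b" "less_O (2 ^ b) a"
      "\<forall>\<psi>\<in>G. \<exists>c ys i. has_index L PiK c ys i \<psi> \<and> (c = b \<or> less_O c b)" by auto
    from insert.prems obtain c ys i where c: "has_index L PiK c ys i \<psi>" "less_O (2 ^ c) a" by blast
    have "in_O c" using c has_index_in_O by blast
    then have "b = c \<or> less_O b c \<or> less_O c b"
      using b c a below by (intro less_O_linear[of a]) auto
    then show ?case
    proof (elim disjE)
      assume "less_O b c"
      then have "\<forall>\<psi>\<in>G. \<exists>c' ys i. has_index L PiK c' ys i \<psi> \<and> (c' = c \<or> less_O c' c)"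
        using b(3) less_O_trans by blast
      with c \<open>in_O c\<close> show ?thesis by (intro exI[of _ c]) auto
    qed (use b c in \<open>intro exI[of _ b]; auto\<close>)+
  qed
  then obtain b where b: "in_O b" "less_O (2 ^ b) a"
    and G: "\<And>\<psi>. \<psi> \<in> G \<Longrightarrow> \<exists>c ys i. has_index L PiK c ys i \<psi> \<and> (c = b \<or> less_O c b)" by blast
  show ?thesis
  proof (cases "b = 1")
    case True
    then have qf: "finitary_qf \<psi> \<and> wf_form L \<psi>" if "\<psi> \<in> G" for \<psi>
    proof -
      from G[OF that] True obtain ys i where "has_index L PiK 1 ys i \<psi>"
        using not_less_O_1 by auto
      then show ?thesis using has_index_1 has_index_wf_form by blast
    qed
    then obtain \<delta> where \<delta>: "finitary_qf \<delta>" "wf_form L \<delta>" "\<forall>A s. sat A \<delta> s \<longleftrightarrow> (\<forall>\<psi>\<in>G. sat A \<psi> s)"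
      using finitary_qf_finite_conj[OF assms(2) qf] by auto
    from has_index_qf[OF this(1,2)] obtain xs i where "has_index L PiK 1 xs i \<delta>" by blast
    with \<delta>(3) b True show ?thesis by blast
  next
    case False
    have "Pi_definable L b (\<lambda>A s. \<forall>\<psi>\<in>G. sat A \<psi> s)"
      using assms(2) G
    proof (induction rule: finite_induct)
      case empty
      show ?case using Pi_definable_True by simp
    next
      case (insert \<psi> G)
      obtain c ys i where "has_index L PiK c ys i \<psi>" "c = b \<or> less_O c b"
        using insert.prems by blast
      then have "Pi_definable L b (\<lambda>A. sat A \<psi>)" using False by (rule Pi_definable_sat)
      then show ?case using Pi_definable_conj insert by simp
    qed
    from Pi_definable_index[OF this b(1) False] b(2) show ?thesis by blast
  qed
qed

text \<open>One existential block costs one level: the quantified formula is the only disjunct of a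
  \<Sigma> formula with the successor notation \<open>2 ^ b\<close>.\<close>

lemma computable_Sigma_below_Exs:
  assumes "has_index L PiK b zs i \<theta>" "less_O (2 ^ b) a" "distinct xs"
  shows "\<exists>us \<phi>. set us = set zs - set xs \<and> computable_Sigma_below L a xs \<phi> \<and> free_vars \<phi> \<subseteq> set xs \<and>
    (\<forall>A s. sat A \<phi> s \<longleftrightarrow> sat A (Exs us \<theta>) s)"
proof -
  obtain us where us: "set us = set zs - set xs"
    using finite_list[of "set zs - set xs"] by auto
  define n where "n = prod_encode (i, list_encode us)"
  have n: "part_index n = i" "part_vars n = us"
    by (simp_all add: n_def part_index_def part_vars_def)
  obtain e where e: "W e = {n}" using ce_singleton unfolding ce_def by blast
  have b: "in_O b" using assms(1) by (rule has_index_in_O)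
  have "has_index L SigmaK (2 ^ b) xs (index SigmaK (2 ^ b) xs e)
      (Disj (W e) (\<lambda>n. Exs (part_vars n) \<theta>))"
    using assms b us in_O_not_0[OF b]
    by (intro has_index.Sigma[where b = "\<lambda>_. b" and ys = "\<lambda>_. zs"])
      (auto simp: e n intro: in_O_succ less_O_succ)
  then have "computable_Sigma_below L a xs (Disj (W e) (\<lambda>n. Exs (part_vars n) \<theta>))"
      and "free_vars (Disj (W e) (\<lambda>n. Exs (part_vars n) \<theta>)) \<subseteq> set xs"
    using assms(2) has_index_free_vars
    unfolding computable_Sigma_below_def computable_Sigma_def by blast+
  then show ?thesis
    using us by (intro exI conjI) (auto simp: e n)
qed

section \<open>Conditions on copies of a structure\<close>

lemma tm_val_isomorphism:
  assumes "isomorphism L A B h"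
  shows "wf_trm L t \<Longrightarrow> tm_val B (h \<circ> s) t = h (tm_val A s t)"
proof (induction t)
  case (App f ts)
  then have "tm_val B (h \<circ> s) u = h (tm_val A s u)" if "u \<in> set ts" for u
    using that by (intro App.IH) auto
  then have "map (tm_val B (h \<circ> s)) ts = map (\<lambda>u. h (tm_val A s u)) ts" by (rule map_cong[OF refl])
  then have eq: "map (tm_val B (h \<circ> s)) ts = map h (map (tm_val A s) ts)" by (simp add: comp_def)
  have "fun_int B f (map h (map (tm_val A s) ts)) = h (fun_int A f (map (tm_val A s) ts))"
    using App.prems assms by (simp add: isomorphism_def del: map_map)
  then show ?case by (simp only: tm_val.simps eq)
qed simp

lemma sat_isomorphism:
  assumes h: "isomorphism L A B h"
  shows "wf_form L \<phi> \<Longrightarrow> sat B \<phi> (h \<circ> s) \<longleftrightarrow> sat A \<phi> s"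
proof (induction \<phi> arbitrary: s)
  case (Eq t u)
  then have "tm_val B (h \<circ> s) t = h (tm_val A s t)" "tm_val B (h \<circ> s) u = h (tm_val A s u)"
    using tm_val_isomorphism[OF h] by auto
  moreover have "inj h" using h by (simp add: isomorphism_def bij_def)
  ultimately show ?case unfolding sat.simps by (simp only: inj_eq)
next
  case (Rel r ts)
  then have "map (tm_val B (h \<circ> s)) ts = map (\<lambda>u. h (tm_val A s u)) ts"
    by (intro map_cong[OF refl] tm_val_isomorphism[OF h]) auto
  then have eq: "map (tm_val B (h \<circ> s)) ts = map h (map (tm_val A s) ts)" by (simp add: comp_def)
  show ?case
    using h Rel unfolding sat.simps eq by (simp add: isomorphism_def del: map_map)
next
  case (Ex x \<phi>)
  have upd: "(h \<circ> s)(x := h v) = h \<circ> s(x := v)" for v by auto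
  have eq: "sat B \<phi> ((h \<circ> s)(x := h v)) \<longleftrightarrow> sat A \<phi> (s(x := v))" for v
    unfolding upd by (rule Ex.IH) (use Ex.prems in simp)
  have "surj h" using h by (simp add: isomorphism_def bij_def)
  then have surj: "(\<exists>w. Q w) \<longleftrightarrow> (\<exists>v. Q (h v))" for Q by (metis surj_def)
  then show ?case by (simp only: sat.simps eq surj[of "\<lambda>w. sat B \<phi> ((h \<circ> s)(x := w))"])
next
  case (All x \<phi>)
  have upd: "(h \<circ> s)(x := h v) = h \<circ> s(x := v)" for v by auto
  have eq: "sat B \<phi> ((h \<circ> s)(x := h v)) \<longleftrightarrow> sat A \<phi> (s(x := v))" for v
    unfolding upd by (rule All.IH) (use All.prems in simp)
  have "surj h" using h by (simp add: isomorphism_def bij_def)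
  then have surj: "(\<forall>w. Q w) \<longleftrightarrow> (\<forall>v. Q (h v))" for Q by (metis surj_def)
  then show ?case by (simp only: sat.simps eq surj[of "\<lambda>w. sat B \<phi> ((h \<circ> s)(x := w))"])
qed auto

lemma isomorphism_id: "isomorphism L A A (\<lambda>x. x)"
  by (simp add: isomorphism_def bij_betw_id_iff[of UNIV] flip: id_def)

text \<open>Complements of finite sets are countably infinite, so any bijection between them
  completes the finite injection. Finitely many distinct values of a copy map can thus be prescribed
  freely.\<close>

lemma bij_extension:
  fixes f :: "nat \<Rightarrow> nat"
  assumes "finite E" "inj_on f E"
  shows "\<exists>h. bij h \<and> (\<forall>e\<in>E. h e = f e)"
proof -
  have "infinite (- E)" "infinite (- f ` E)"
    using assms(1) by (simp_all add: finite_compl)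
  then have g: "bij_betw (from_nat_into (- f ` E) \<circ> to_nat_on (- E)) (- E) (- f ` E)"
    by (intro bij_betw_trans[OF to_nat_on_infinite] bij_betw_from_nat_into) auto
  have f: "bij_betw f E (f ` E)" using assms(2) by (simp add: bij_betw_def)
  have "bij_betw (\<lambda>x. if x \<in> E then f x else (from_nat_into (- f ` E) \<circ> to_nat_on (- E)) x)
      (E \<union> - E) (f ` E \<union> - f ` E)"
    by (rule bij_betw_disjoint_Un[OF f g]) auto
  then show ?thesis by (intro exI conjI) auto
qed

fun part :: "nat \<Rightarrow> form \<Rightarrow> form" where
  "part n (Conj I \<Phi>) = \<Phi> n"
| "part n (Disj I \<Phi>) = \<Phi> n"
| "part n (Ex x \<phi>) = \<phi>"
| "part n (All x \<phi>) = \<phi>"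
| "part n \<phi> = \<phi>"

definition parts :: "form \<Rightarrow> form set" where
  "parts \<phi> = range (\<lambda>ns. fold part ns \<phi>)"

lemma countable_parts: "countable (parts \<phi>)"
  unfolding parts_def by simp

lemma self_in_parts: "\<phi> \<in> parts \<phi>"
  unfolding parts_def by (rule range_eqI[of _ _ "[]"]) simp

lemma part_in_parts: "\<psi> \<in> parts \<phi> \<Longrightarrow> part n \<psi> \<in> parts \<phi>"
  unfolding parts_def
proof (elim rangeE)
  fix ns assume "\<psi> = fold part ns \<phi>"
  then show "part n \<psi> \<in> range (\<lambda>ns. fold part ns \<phi>)"
    by (intro range_eqI[of _ _ "ns @ [n]"]) simp
qed

lemma Exs_in_partsD: "Exs us \<psi> \<in> parts \<phi> \<Longrightarrow> \<psi> \<in> parts \<phi>"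
  by (induction us) (auto dest: part_in_parts[of _ _ 0])

lemma Alls_in_partsD: "Alls us \<psi> \<in> parts \<phi> \<Longrightarrow> \<psi> \<in> parts \<phi>"
  by (induction us) (auto dest: part_in_parts[of _ _ 0])

definition finsupp :: "(nat \<Rightarrow> nat) \<Rightarrow> bool" where
  "finsupp \<sigma> \<longleftrightarrow> finite {x. \<sigma> x \<noteq> 0}"

definition of_list :: "nat list \<Rightarrow> nat \<Rightarrow> nat" where
  "of_list l x = (if x < length l then l ! x else 0)"

lemma finsupp_of_list: "finsupp (of_list l)"
  unfolding finsupp_def of_list_def by (rule finite_subset[of _ "{..<length l}"]) auto

lemma finsupp_change:
  assumes "finsupp \<sigma>" "finite X" "\<And>x. x \<notin> X \<Longrightarrow> \<sigma>' x = \<sigma> x"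
  shows "finsupp \<sigma>'"
  unfolding finsupp_def
proof (rule finite_subset)
  show "{x. \<sigma>' x \<noteq> 0} \<subseteq> {x. \<sigma> x \<noteq> 0} \<union> X" using assms(3) by fastforce
qed (use assms in \<open>simp add: finsupp_def\<close>)

lemma countable_finsupp: "countable (Collect finsupp)"
proof -
  have "\<sigma> \<in> range of_list" if "finsupp \<sigma>" for \<sigma>
  proof -
    from that obtain n where "\<And>x. \<sigma> x \<noteq> 0 \<Longrightarrow> x < n"
      unfolding finsupp_def finite_nat_set_iff_bounded by blast
    then have "\<sigma> = of_list (map \<sigma> [0..<n])"
      by (auto simp: of_list_def fun_eq_iff)
    then show ?thesis by blast
  qed
  then have "Collect finsupp \<subseteq> range of_list" by blast
  then show ?thesis by (rule countable_subset) simp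
qed

lemma map_of_list: "map (h \<circ> of_list xs) [0..<length xs] = map h xs"
  by (auto simp: of_list_def intro: nth_equalityI)

lemma sat_Rel_of_list:
  "sat A (Rel r (map Var [0..<length xs])) (h \<circ> of_list xs) \<longleftrightarrow> rel_int A r (map h xs)"
  using map_of_list[of h xs] by (simp add: comp_def)

lemma sat_fun_of_list:
  "sat A (Eq (App f (map Var [0..<length xs])) (Var (length xs))) (h \<circ> of_list (xs @ [v])) \<longleftrightarrow>
    fun_int A f (map h xs) = h v"
proof -
  have "map (h \<circ> of_list (xs @ [v])) [0..<length xs] = map (h \<circ> of_list xs) [0..<length xs]"
    by (auto simp: of_list_def nth_append)
  with map_of_list[of h xs] show ?thesis by (simp add: comp_def of_list_def)
qed

text \<open>The Rasiowa-Sikorski lemma: the countably many dense sets are enumerated, and the k-th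
  one is entered at stage k + 1.\<close>

lemma generic_chain:
  fixes \<D> :: "'a set set set"
  assumes "countable \<D>" "ok {}"
    and dense: "\<And>D P. D \<in> \<D> \<Longrightarrow> ok P \<Longrightarrow> \<exists>P'. ok P' \<and> P \<subseteq> P' \<and> P' \<in> D"
  shows "\<exists>P :: nat \<Rightarrow> 'a set. (\<forall>k. ok (P k)) \<and> (\<forall>k l. k \<le> l \<longrightarrow> P k \<subseteq> P l) \<and> (\<forall>D\<in>\<D>. \<exists>k. P k \<in> D)"
proof (cases "\<D> = {}")
  case True
  with assms(2) show ?thesis by auto
next
  case False
  have "\<exists>P. \<forall>k. ok (P k) \<and> P k \<subseteq> P (Suc k) \<and> P (Suc k) \<in> from_nat_into \<D> k"
  proof (rule dependent_nat_choice[where P = "\<lambda>_. ok"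
        and Q = "\<lambda>k P P'. P \<subseteq> P' \<and> P' \<in> from_nat_into \<D> k"])
    show "\<exists>P. ok P" using assms(2) by blast
  next
    fix P k assume "ok P"
    then show "\<exists>P'. ok P' \<and> (P \<subseteq> P' \<and> P' \<in> from_nat_into \<D> k)"
      using dense from_nat_into[OF False] by blast
  qed
  then obtain P where P: "\<And>k. ok (P k)" "\<And>k. P k \<subseteq> P (Suc k)" "\<And>k. P (Suc k) \<in> from_nat_into \<D> k"
    by blast
  have "\<exists>k. P k \<in> D" if "D \<in> \<D>" for D
    using P(3) from_nat_into_surj[OF assms(1) that] by metis
  with P lift_Suc_mono_le[of P] show ?thesis by blast
qed

section \<open>Conditions and the definability of their solution sets\<close>

locale scott_structure =
  fixes L :: lang and A :: struct and a :: nat and \<phi> :: form and ix :: nat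
  assumes two_less: "less_O 2 a"
    and index_\<phi>: "has_index L PiK a [] ix \<phi>"
    and scott: "scott_sentence L A \<phi>"
begin

definition low :: "form \<Rightarrow> bool" where
  "low \<psi> \<longleftrightarrow> (\<exists>b ys i. has_index L PiK b ys i \<psi> \<and> less_O (2 ^ b) a)"

definition basics :: "form set" where
  "basics = {\<psi>. (\<psi> \<in> parts \<phi> \<or> finitary_qf \<psi>) \<and> low \<psi>}"

text \<open>A bijection \<open>h\<close> stands for the copy of \<open>A\<close> that it maps isomorphically onto \<open>A\<close>. A
  constraint \<open>(\<psi>, \<sigma>)\<close> requires \<open>\<psi>\<close> in that copy, where \<open>\<sigma>\<close> assigns elements of the copy to the
  variables. Finite supports keep the set of requirements on a generic sequence countable.\<close>

definition cond :: "(form \<times> (nat \<Rightarrow> nat)) set \<Rightarrow> bool" where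
  "cond P \<longleftrightarrow> finite P \<and> (\<forall>(\<psi>, \<sigma>)\<in>P. \<psi> \<in> basics \<and> finsupp \<sigma>)"

definition Mod :: "(form \<times> (nat \<Rightarrow> nat)) set \<Rightarrow> (nat \<Rightarrow> nat) set" where
  "Mod P = {h. bij h \<and> (\<forall>(\<psi>, \<sigma>)\<in>P. sat A \<psi> (h \<circ> \<sigma>))}"

definition val :: "(form \<times> (nat \<Rightarrow> nat)) set \<Rightarrow> nat list \<Rightarrow> nat list set" where
  "val P c = (\<lambda>h. map h c) ` Mod P"

text \<open>Level 0 has notation 1, and its successor \<open>2 ^ 1\<close> is below \<open>a\<close>
  because \<alpha> is at least 2.\<close>

lemma qf_in_basics: "finitary_qf \<delta> \<Longrightarrow> wf_form L \<delta> \<Longrightarrow> \<delta> \<in> basics"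
  using has_index_qf[of \<delta> L PiK] two_less unfolding basics_def low_def by fastforce

lemma basics_wf_form: "\<psi> \<in> basics \<Longrightarrow> wf_form L \<psi>"
  unfolding basics_def low_def by (auto dest: has_index_wf_form)

lemma finite_free_vars_basics: "\<psi> \<in> basics \<Longrightarrow> finite (free_vars \<psi>)"
  unfolding basics_def low_def by (auto dest: has_index_free_vars finite_subset)

lemma cond_empty: "cond {}" by (simp add: cond_def)

lemma cond_insert: "cond P \<Longrightarrow> \<psi> \<in> basics \<Longrightarrow> finsupp \<sigma> \<Longrightarrow> cond (insert (\<psi>, \<sigma>) P)"
  by (auto simp: cond_def)

lemma Mod_insert: "h \<in> Mod (insert (\<psi>, \<sigma>) P) \<longleftrightarrow> h \<in> Mod P \<and> sat A \<psi> (h \<circ> \<sigma>)"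
  by (auto simp: Mod_def)

lemma Mod_bij: "h \<in> Mod P \<Longrightarrow> bij h" by (simp add: Mod_def)

lemma Mod_antimono: "P \<subseteq> P' \<Longrightarrow> Mod P' \<subseteq> Mod P" by (auto simp: Mod_def)

text \<open>Only the values of a copy map on the finite set \<open>E\<close> of mentioned elements
  matter, and by \<open>bij_extension\<close> any distinct values are possible there. So the
  existence of a copy meeting \<open>P\<close> reduces to that of finitely many distinct elements of
  A that satisfy the constraints.\<close>

lemma val_definable:
  assumes "cond P"
  shows "\<exists>xs \<theta>. computable_Sigma_below L a xs \<theta> \<and> defines_in A xs \<theta> (val P c)"
proof -
  obtain ps where ps: "set ps = P" using assms finite_list unfolding cond_def by blast
  define n where "n = length ps"
  define \<psi> where "\<psi> i = fst (ps ! i)" for i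
  define \<sigma> where "\<sigma> i = snd (ps ! i)" for i
  have P: "(\<forall>(\<psi>, \<sigma>)\<in>P. F \<psi> \<sigma>) \<longleftrightarrow> (\<forall>i<n. F (\<psi> i) (\<sigma> i))" for F
    by (simp add: ps[symmetric] all_set_conv_all_nth n_def \<psi>_def \<sigma>_def case_prod_beta)
  have basic: "\<psi> i \<in> basics" if "i < n" for i
    using assms that P[of "\<lambda>\<psi> \<sigma>. \<psi> \<in> basics \<and> finsupp \<sigma>"] by (simp add: cond_def)
  have Mod: "h \<in> Mod P \<longleftrightarrow> bij h \<and> (\<forall>i<n. sat A (\<psi> i) (h \<circ> \<sigma> i))" for h
    using P[of "\<lambda>\<psi> \<sigma>. sat A \<psi> (h \<circ> \<sigma>)"] by (simp add: Mod_def)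
  \<comment> \<open>Each constraint gets its own variables, since different constraints may assign
    different elements to one variable. The values of \<sigma> are imposed by equations:
    substituting along \<sigma> directly could identify variables, whereas \<open>t i\<close> has
    the computable left inverse that renaming needs.\<close>
  define t where "t i x = prod_encode (Suc (Suc i), x)" for i x
  have "recursive (t i)" for i unfolding t_def by (intro recursive_intros)
  then have "\<exists>R. \<forall>L K b ys j \<psi>. has_index L K b ys j \<psi> \<longrightarrow>
    (\<exists>\<psi>'. has_index L K b (map (t i) ys) (R j) \<psi>' \<and> (\<forall>A s. sat A \<psi>' s \<longleftrightarrow> sat A \<psi> (s \<circ> t i)))" for i
    by (rule rename_index[OF _ recursive_psnd[OF recursive_id]]) (simp add: t_def)
  then have "\<exists>\<psi>'. low \<psi>' \<and>
      (\<forall>A s. sat A \<psi>' s \<longleftrightarrow> sat A (\<psi> i) (s \<circ> t i))" if "i < n" for i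
    using basic[OF that] unfolding basics_def low_def by blast
  then obtain \<psi>' where \<psi>': "\<And>i. i < n \<Longrightarrow> low (\<psi>' i)"
    "\<And>i A s. i < n \<Longrightarrow> sat A (\<psi>' i) s \<longleftrightarrow> sat A (\<psi> i) (s \<circ> t i)"
    by metis
  \<comment> \<open>\<open>x j\<close> stands for entry j of the tuple and \<open>z e\<close> for
    the image of the element e under the copy map. The first components 0, 1 and i + 2 keep the
    kinds of variables apart.\<close>
  define x where "x j = prod_encode (0, j)" for j
  define z where "z e = prod_encode (1, e)" for e
  define E where "E = set c \<union> (\<Union>i<n. \<sigma> i ` free_vars (\<psi> i))"
  have fin: "finite (free_vars (\<psi> i))" if "i < n" for i
    using basic[OF that] by (rule finite_free_vars_basics)
  then have "finite E" by (auto simp: E_def)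
  define G where "G = \<psi>' ` {..<n} \<union>
    (\<lambda>(i, y). Eq (Var (t i y)) (Var (z (\<sigma> i y)))) ` (SIGMA i:{..<n}. free_vars (\<psi> i)) \<union>
    (\<lambda>j. Eq (Var (x j)) (Var (z (c ! j)))) ` {..<length c} \<union>
    (\<lambda>(e, e'). Neg (Eq (Var (z e)) (Var (z e')))) ` {(e, e') \<in> E \<times> E. e \<noteq> e'}"
  have "finite {(e, e') \<in> E \<times> E. e \<noteq> e'}"
    by (rule finite_subset[of _ "E \<times> E"]) (use \<open>finite E\<close> in auto)
  then have "finite G"
    unfolding G_def by (intro finite_UnI finite_imageI finite_SigmaI) (auto simp: fin)
  have lit: "low \<delta>" if "finitary_qf \<delta>" "wf_form L \<delta>" for \<delta>
    using qf_in_basics[OF that] unfolding basics_def by blast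
  have "low \<delta>" if "\<delta> \<in> G" for \<delta>
    using that unfolding G_def by (auto intro: \<psi>'(1) lit finitary_qf.intros finitary_qf.intros(3)[OF finitary_qf.intros(1)])
  from finite_conj_Pi[OF two_less \<open>finite G\<close> this[unfolded low_def]] obtain b zs i \<theta> where
    \<theta>: "has_index L PiK b zs i \<theta>" "less_O (2 ^ b) a" "\<And>A s. sat A \<theta> s \<longleftrightarrow> (\<forall>\<psi>\<in>G. sat A \<psi> s)"
    by blast
  define xs where "xs = map x [0..<length c]"
  have "distinct xs" by (simp add: xs_def distinct_map inj_on_def x_def)
  from computable_Sigma_below_Exs[OF \<theta>(1,2) this] obtain us \<theta>' where
    us: "set us = set zs - set xs" and \<theta>': "computable_Sigma_below L a xs \<theta>'" "free_vars \<theta>' \<subseteq> set xs"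
    "\<And>A s. sat A \<theta>' s \<longleftrightarrow> sat A (Exs us \<theta>) s"
    by blast
  have sat: "sat A \<theta> s \<longleftrightarrow> (\<forall>i<n. sat A (\<psi> i) (s \<circ> t i)) \<and>
    (\<forall>i<n. \<forall>y\<in>free_vars (\<psi> i). s (t i y) = s (z (\<sigma> i y))) \<and>
    (\<forall>j<length c. s (x j) = s (z (c ! j))) \<and> inj_on (s \<circ> z) E" for s
    unfolding \<theta> G_def ball_Un
    by (auto simp: \<psi>'(2) inj_on_def)
  have "val P c = {map s xs | s. sat A \<theta>' s}"
  proof (intro set_eqI iffI)
    fix w assume "w \<in> val P c"
    then obtain h where h: "h \<in> Mod P" "w = map h c" by (auto simp: val_def)
    define s where "s m = (if pfst m = 0 then h (c ! psnd m) else if pfst m = 1 then h (psnd m)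
      else h (\<sigma> (pfst m - 2) (psnd m)))" for m
    have s: "s (x j) = h (c ! j)" "s (z e) = h e" "s (t i y) = h (\<sigma> i y)" for i j e y
      by (simp_all add: s_def x_def z_def t_def)
    have "s \<circ> t i = h \<circ> \<sigma> i" for i by (auto simp: s)
    moreover have "sat A (\<psi> i) (h \<circ> \<sigma> i)" if "i < n" for i
      using h(1) that unfolding Mod by blast
    moreover have "s \<circ> z = h" by (rule ext) (simp only: comp_apply s)
    then have "inj_on (s \<circ> z) E"
      using inj_on_subset[OF bij_is_inj[OF Mod_bij[OF h(1)]]] by simp
    ultimately have "sat A \<theta> s" unfolding sat using s by metis
    then have "sat A \<theta>' s" unfolding \<theta>' sat_Exs by blast
    moreover have "w = map s xs" by (auto simp: h xs_def s intro: nth_equalityI)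
    ultimately show "w \<in> {map s xs | s. sat A \<theta>' s}" by blast
  next
    fix w assume "w \<in> {map s xs | s. sat A \<theta>' s}"
    then obtain s s' where w: "w = map s xs" and s': "\<forall>x. x \<notin> set us \<longrightarrow> s' x = s x" "sat A \<theta> s'"
      unfolding \<theta>' sat_Exs by blast
    have "w = map s' xs" using s'(1) us w by simp
    from s'(2) have "inj_on (s' \<circ> z) E" unfolding sat by blast
    then obtain h where h: "bij h" "\<And>e. e \<in> E \<Longrightarrow> h e = s' (z e)"
      using bij_extension[OF \<open>finite E\<close>] by (metis comp_apply)
    have "sat A (\<psi> i) (h \<circ> \<sigma> i)" if "i < n" for i
    proof -
      have "(h \<circ> \<sigma> i) y = (s' \<circ> t i) y" if "y \<in> free_vars (\<psi> i)" for y
        using that \<open>i < n\<close> s'(2) h(2)[of "\<sigma> i y"] unfolding sat by (auto simp: E_def)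
      then have "sat A (\<psi> i) (h \<circ> \<sigma> i) \<longleftrightarrow> sat A (\<psi> i) (s' \<circ> t i)" by (rule sat_cong)
      with that s'(2) show ?thesis unfolding sat by blast
    qed
    with h(1) have "h \<in> Mod P" unfolding Mod by blast
    moreover have "w = map h c"
    proof (rule nth_equalityI)
      fix j assume "j < length w"
      then have j: "j < length c" by (simp add: w xs_def)
      then have "s' (x j) = s' (z (c ! j))" "c ! j \<in> E" using s'(2) unfolding sat by (auto simp: E_def)
      with j \<open>w = map s' xs\<close> h(2) show "w ! j = map h c ! j" by (simp add: xs_def)
    qed (simp add: w xs_def)
    ultimately show "w \<in> val P c" by (auto simp: val_def)
  qed
  then have "defines_in A xs \<theta>' (val P c)"
    using \<open>distinct xs\<close> \<theta>'(2) unfolding defines_in_def by blast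
  with \<theta>'(1) show ?thesis by blast
qed

text \<open>The sets \<^term>\<open>val P c\<close> play the role of the formulas. A tuple is supported if one of them
  isolates its type.\<close>

definition supported :: "nat list \<Rightarrow> bool" where
  "supported p \<longleftrightarrow> (\<exists>P c. cond P \<and> val P c \<noteq> {} \<and>
    (\<forall>b\<in>val P c. \<forall>V d. cond V \<longrightarrow> b \<in> val V d \<longrightarrow> p \<in> val V d))"

text \<open>Witnesses found in A are pulled back along \<open>h\<close>, so the same copy meets the
  enlarged condition.\<close>

lemma extend:
  assumes "cond P" "h \<in> Mod P" "\<psi> \<in> basics" "finsupp \<sigma>" "sat A (Exs us \<psi>) (h \<circ> \<sigma>)"
  shows "\<exists>\<sigma>'. finsupp \<sigma>' \<and> (\<forall>x. x \<notin> set us \<longrightarrow> \<sigma>' x = \<sigma> x) \<and>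
    cond (insert (\<psi>, \<sigma>') P) \<and> h \<in> Mod (insert (\<psi>, \<sigma>') P)"
proof -
  from assms(5) obtain s where s: "\<And>x. x \<notin> set us \<Longrightarrow> s x = h (\<sigma> x)" "sat A \<psi> s"
    unfolding sat_Exs by auto
  define \<sigma>' where "\<sigma>' = inv h \<circ> s"
  have h: "bij h" using assms(2) by (rule Mod_bij)
  then have "h \<circ> \<sigma>' = s" by (auto simp: \<sigma>'_def bij_def surj_f_inv_f)
  moreover have \<sigma>': "\<sigma>' x = \<sigma> x" if "x \<notin> set us" for x
    using s(1)[OF that] h by (simp add: \<sigma>'_def bij_def)
  moreover have "finsupp \<sigma>'" using finsupp_change[OF assms(4) finite_set \<sigma>'] .
  ultimately show ?thesis
    using assms s(2) by (intro exI[of _ \<sigma>']) (simp add: cond_insert Mod_insert)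
qed

text \<open>As \<open>p\<close> is unsupported, some b at the places \<open>c\<close> of a copy
  meeting \<open>P\<close> also occurs at places d of a copy meeting a condition V, while
  \<open>p\<close> never occurs there. Transporting V so that d becomes \<open>c\<close> and adding
  it to \<open>P\<close> keeps \<open>h\<close> as a copy. Any copy with \<open>p\<close> at
  \<open>c\<close> would then put \<open>p\<close> at d in a copy meeting V.\<close>

lemma extend_omit:
  assumes "cond P" "Mod P \<noteq> {}" "\<not> supported p"
  shows "\<exists>P'. cond P' \<and> Mod P' \<noteq> {} \<and> P \<subseteq> P' \<and> (\<forall>h\<in>Mod P'. map h c \<noteq> p)"
proof -
  have "val P c \<noteq> {}" using assms(2) by (simp add: val_def)
  with assms obtain b V d where V: "b \<in> val P c" "cond V" "b \<in> val V d" "p \<notin> val V d"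
    unfolding supported_def by blast
  then obtain h h' where h: "h \<in> Mod P" "map h c = b" and h': "h' \<in> Mod V" "map h' d = b"
    by (auto simp: val_def)
  \<comment> \<open>\<open>g\<close> carries the copy that meets \<open>V\<close> onto the one that meets \<open>P\<close>.\<close>
  define g where "g = inv h \<circ> h'"
  have bij: "bij h" "bij h'" using h h' Mod_bij by auto
  then have hg: "h \<circ> g = h'" by (auto simp: g_def bij_def surj_f_inv_f)
  have "bij g" using bij unfolding g_def by (intro bij_comp bij_imp_bij_inv)
  have "map g d = map (inv h) b" by (simp add: g_def flip: h'(2))
  also have "\<dots> = c" using bij(1) by (simp add: bij_def flip: h(2))
  finally have gd: "map g d = c" .
  \<comment> \<open>\<open>g \<circ> \<sigma>\<close> is not finitely supported when g moves 0, so
    the assignment is reset to 0 off the free variables, where satisfaction does not notice.\<close>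
  define trim where "trim \<psi> \<sigma> x = (if x \<in> free_vars \<psi> then g (\<sigma> x) else 0)" for \<psi> \<sigma> x
  have trim: "sat A \<psi> (k \<circ> trim \<psi> \<sigma>) \<longleftrightarrow> sat A \<psi> ((k \<circ> g) \<circ> \<sigma>)" for \<psi> k \<sigma>
    by (rule sat_cong) (simp add: trim_def)
  define P' where "P' = P \<union> (\<lambda>(\<psi>, \<sigma>). (\<psi>, trim \<psi> \<sigma>)) ` V"
  have Mod: "k \<in> Mod P' \<longleftrightarrow> k \<in> Mod P \<and> k \<circ> g \<in> Mod V" if "bij k" for k
    using bij_comp[OF \<open>bij g\<close> that] that
    unfolding P'_def Mod_def by (auto simp: trim case_prod_beta ball_Un)
  have "finsupp (trim \<psi> \<sigma>)" if "\<psi> \<in> basics" for \<psi> \<sigma>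
    unfolding finsupp_def
    by (rule finite_subset[OF _ finite_free_vars_basics[OF that]]) (auto simp: trim_def)
  then have "cond P'" using assms(1) V(2) unfolding cond_def P'_def by auto
  moreover have "h \<in> Mod P'" using Mod bij h h' hg by simp
  moreover have "map k c \<noteq> p" if "k \<in> Mod P'" for k
  proof
    assume "map k c = p"
    then have "map (k \<circ> g) d = p" by (simp flip: gd)
    moreover have "k \<circ> g \<in> Mod V" using that Mod Mod_bij by blast
    ultimately show False using V(4) unfolding val_def by blast
  qed
  ultimately show ?thesis by (intro exI[of _ P']) (auto simp: P'_def)
qed

end

section \<open>Back and forth\<close>

context scott_structure
begin

definition eqv :: "nat list \<Rightarrow> nat list \<Rightarrow> bool" where
  "eqv p q \<longleftrightarrow> (\<forall>V d. cond V \<longrightarrow> (p \<in> val V d \<longleftrightarrow> q \<in> val V d))"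

lemma eqv_sym: "eqv p q \<Longrightarrow> eqv q p"
  by (simp add: eqv_def)

lemma Mod_empty: "Mod {} = {h. bij h}"
  by (simp add: Mod_def)

lemma self_in_val: "p \<in> val {} p"
  unfolding val_def Mod_empty by (rule image_eqI[of _ _ id]) auto

text \<open>Already the empty condition, with the entries of \<open>p\<close> as places, records the
  length and the equality pattern of \<open>p\<close>.\<close>

lemma eqv_map:
  assumes "eqv p q"
  shows "\<exists>g. bij g \<and> q = map g p"
proof -
  have "q \<in> val {} p" using assms self_in_val cond_empty unfolding eqv_def by blast
  then show ?thesis by (auto simp: val_def Mod_empty)
qed

text \<open>A itself, as its own copy under \<open>id\<close>, meets the condition given by
  \<delta>. So \<open>p\<close> lies in a solution set to which the equivalent tuple must belong as
  well.\<close>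

lemma eqv_qf:
  assumes "eqv p (map h p)" "finitary_qf \<delta>" "wf_form L \<delta>"
    and fv: "free_vars \<delta> \<subseteq> {..<length xs}" and xs: "set xs \<subseteq> set p"
    and sat: "sat A \<delta> (of_list xs)"
  shows "sat A \<delta> (h \<circ> of_list xs)"
proof -
  define V where "V = {(\<delta>, of_list xs)}"
  have "cond V"
    using cond_insert[OF cond_empty qf_in_basics[OF assms(2,3)] finsupp_of_list] by (simp add: V_def)
  moreover have "id \<in> Mod V" using sat by (simp add: V_def Mod_def)
  then have "p \<in> val V p" unfolding val_def by (rule image_eqI[rotated]) simp
  ultimately have "map h p \<in> val V p" using assms(1) unfolding eqv_def by blast
  then obtain g where "g \<in> Mod V" and gh: "map h p = map g p" unfolding val_def by blast
  then have g: "sat A \<delta> (g \<circ> of_list xs)" by (simp add: Mod_def V_def)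
  have "(g \<circ> of_list xs) x = (h \<circ> of_list xs) x" if "x \<in> free_vars \<delta>" for x
  proof -
    have "x < length xs" using that fv by auto
    then have "xs ! x \<in> set p" using xs nth_mem by blast
    then have "g (xs ! x) = h (xs ! x)" using gh by simp
    with \<open>x < length xs\<close> show ?thesis by (simp add: of_list_def)
  qed
  with g sat_cong[of \<delta>] show ?thesis by blast
qed

text \<open>Support only includes the type of b in that of \<open>p\<close>. The converse uses
  support for b: a set isolating b contains b, hence \<open>p\<close>, and so every solution set
  containing \<open>p\<close> contains b.\<close>

lemma supported_eqv:
  assumes "\<And>p. supported p"
  shows "\<exists>P c. cond P \<and> p \<in> val P c \<and> (\<forall>b\<in>val P c. eqv p b)"
proof -
  obtain P c where P: "cond P" "val P c \<noteq> {}"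
      "\<And>b V d. b \<in> val P c \<Longrightarrow> cond V \<Longrightarrow> b \<in> val V d \<Longrightarrow> p \<in> val V d"
    using assms[of p] unfolding supported_def by blast
  then have "p \<in> val P c" by blast
  moreover have "eqv p b" if b: "b \<in> val P c" for b
  proof -
    obtain P' c' where P': "cond P'" "val P' c' \<noteq> {}"
        "\<And>e V d. e \<in> val P' c' \<Longrightarrow> cond V \<Longrightarrow> e \<in> val V d \<Longrightarrow> b \<in> val V d"
      using assms[of b] unfolding supported_def by blast
    then have "b \<in> val P' c'" by blast
    then have "p \<in> val P' c'" using P(3)[OF b P'(1)] by blast
    then show ?thesis using P(3)[OF b] P'(3) unfolding eqv_def by blast
  qed
  ultimately show ?thesis using P(1) by blast
qed

text \<open>Dropping the last place from a set isolating \<open>p @ [x]\<close> leaves a solution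
  set containing \<open>p\<close>, hence \<open>q\<close>. A copy that puts \<open>q\<close> there
  supplies y as its value at the dropped place.\<close>

lemma eqv_forth:
  assumes "\<And>p. supported p" "eqv p q"
  shows "\<exists>y. eqv (p @ [x]) (q @ [y])"
proof -
  obtain P c where P: "cond P" "p @ [x] \<in> val P c" "\<And>b. b \<in> val P c \<Longrightarrow> eqv (p @ [x]) b"
    using supported_eqv[OF assms(1), of "p @ [x]"] by blast
  then obtain h where h: "h \<in> Mod P" "map h c = p @ [x]" unfolding val_def by auto
  then obtain c0 c1 where c: "c = c0 @ [c1]" "map h c0 = p"
    by (auto simp: map_eq_append_conv)
  then have "p \<in> val P c0" using h(1) by (auto simp: val_def)
  then have "q \<in> val P c0" using assms(2) P(1) unfolding eqv_def by blast
  then obtain g where "g \<in> Mod P" "map g c0 = q" unfolding val_def by auto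
  then have "q @ [g c1] \<in> val P c" unfolding val_def c(1) by (intro image_eqI[of _ _ g]) auto
  then show ?thesis using P(3) by blast
qed

lemma eqv_orbit:
  assumes supp: "\<And>p. supported p" and "eqv p q"
  shows "\<exists>h. isomorphism L A A h \<and> q = map h p"
proof -
  \<comment> \<open>Stage k puts the number k into both lists, on the left by going forth and on the
    right by going back, so that both exhaust the universe.\<close>
  define step where "step k = (\<lambda>(p, q) (p', q'). \<exists>x y. eqv p' q' \<and>
    p' = p @ [k, x] \<and> q' = q @ [y, k])" for k :: nat
  define good where "good k = (\<lambda>(p', q'). eqv p' q' \<and> (k = 0 \<longrightarrow> p' = p \<and> q' = q))" for k :: nat
  have "\<exists>S. \<forall>k. good k (S k) \<and> step k (S k) (S (Suc k))"
  proof (rule dependent_nat_choice)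
    show "\<exists>pq. good 0 pq" using assms(2) by (intro exI[of _ "(p, q)"]) (simp add: good_def)
  next
    fix pq k assume "good k pq"
    then obtain p' q' where pq: "pq = (p', q')" "eqv p' q'" by (cases pq) (auto simp: good_def)
    obtain y where "eqv (p' @ [k]) (q' @ [y])" using eqv_forth[OF supp pq(2)] by blast
    from eqv_forth[OF supp eqv_sym[OF this]] obtain x where
      "eqv ((q' @ [y]) @ [k]) ((p' @ [k]) @ [x])" by blast
    then have "eqv (p' @ [k, x]) (q' @ [y, k])" using eqv_sym by simp
    then show "\<exists>pq'. good (Suc k) pq' \<and> step k pq pq'"
      by (intro exI[of _ "(p' @ [k, x], q' @ [y, k])"]) (auto simp: step_def good_def pq)
  qed
  then obtain S where S: "\<And>k. good k (S k)" "\<And>k. step k (S k) (S (Suc k))" by blast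
  define P where "P k = fst (S k)" for k
  define Q where "Q k = snd (S k)" for k
  have eqv: "eqv (P k) (Q k)" for k using S(1)[of k] by (auto simp: P_def Q_def good_def)
  have P0: "P 0 = p" "Q 0 = q" using S(1)[of 0] by (auto simp: P_def Q_def good_def)
  have step: "\<exists>x y. P (Suc k) = P k @ [k, x] \<and> Q (Suc k) = Q k @ [y, k]" for k
    using S(2)[of k] by (auto simp: step_def P_def Q_def)
  obtain g where g: "\<And>k. bij (g k)" "\<And>k. Q k = map (g k) (P k)"
    using eqv_map[OF eqv] by metis
  have len: "length (P k) = length (Q k)" for k by (simp add: g(2))
  have ext: "\<exists>u v. P l = P k @ u \<and> Q l = Q k @ v" if "k \<le> l" for k l
    using that
  proof (induction l rule: dec_induct)
    case (step l)
    then show ?case using \<open>\<exists>x y. P (Suc l) = P l @ [l, x] \<and> Q (Suc l) = Q l @ [y, l]\<close> by fastforce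
  qed auto
  have agree: "g l x = g k x" if "k \<le> l" "x \<in> set (P k)" for k l x
  proof -
    obtain u v where "P l = P k @ u" "Q l = Q k @ v" using ext \<open>k \<le> l\<close> by blast
    then have "map (g l) (P k) = Q k" using g(2)[of l] g(2)[of k] by simp
    then show ?thesis using g(2)[of k] that(2) by simp
  qed
  have in_P: "x \<in> set (P k)" if "x < k" for x k
    using step[of x] ext[of "Suc x" k] that by fastforce
  have in_Q: "x \<in> set (Q k)" if "x < k" for x k
    using step[of x] ext[of "Suc x" k] that by fastforce
  \<comment> \<open>The maps \<open>g k\<close> agree where they overlap, and x has entered the left
    list by stage \<open>Suc x\<close>, so that stage fixes its image.\<close>
  define h where "h x = g (Suc x) x" for x
  have h: "h x = g k x" if "x \<in> set (P k)" for x k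
    using agree[of k "max k (Suc x)" x] agree[of "Suc x" "max k (Suc x)" x] that in_P[of x "Suc x"]
    by (simp add: h_def)
  then have Q: "Q k = map h (P k)" for k using g(2)[of k] by simp
  have eqv_h: "eqv (P k) (map h (P k))" for k using eqv[of k] Q[of k] by simp
  have "inj h"
  proof (rule injI)
    fix x y assume *: "h x = h y"
    define k where "k = Suc (max x y)"
    have "x \<in> set (P k)" "y \<in> set (P k)" by (auto simp: k_def intro: in_P)
    with h * have "g k x = g k y" by metis
    with g(1)[of k] show "x = y" by (simp add: bij_def inj_eq)
  qed
  moreover have "surj h"
  proof -
    have "y \<in> range h" for y using in_Q[of y "Suc y"] Q[of "Suc y"] by auto
    then show ?thesis by blast
  qed
  ultimately have "bij h" by (simp add: bij_def)
  have bound: "\<exists>k. set xs \<subseteq> set (P k)" for xs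
  proof -
    have "\<exists>k. \<forall>x\<in>set xs. x < k" using finite_nat_set_iff_bounded by blast
    then show ?thesis using in_P by blast
  qed
  have rel: "rel_int A r (map h xs) = rel_int A r xs" if "r \<in> rel_syms L" "length xs = rel_arity L r" for r xs
  proof -
    obtain k where k: "set xs \<subseteq> set (P k)" using bound by blast
    let ?R = "Rel r (map Var [0..<length xs])"
    have R: "sat A ?R (of_list xs) \<longleftrightarrow> rel_int A r xs"
      using sat_Rel_of_list[of A r xs id] by simp
    have fin: "finitary_qf ?R" "finitary_qf (Neg ?R)" by (auto intro: finitary_qf.intros)
    have wf: "wf_form L ?R" "wf_form L (Neg ?R)" "free_vars ?R \<subseteq> {..<length xs}"
      "free_vars (Neg ?R) \<subseteq> {..<length xs}" using that by auto
    \<comment> \<open>Preservation goes one way, so it is applied to the relation and to its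
      negation.\<close>
    show ?thesis
      using eqv_qf[OF eqv_h fin(1) wf(1,3) k] eqv_qf[OF eqv_h fin(2) wf(2,4) k]
      unfolding sat.simps(3) R sat_Rel_of_list by blast
  qed
  have funs: "fun_int A f (map h xs) = h (fun_int A f xs)"
    if "f \<in> fun_syms L" "length xs = fun_arity L f" for f xs
  proof -
    \<comment> \<open>The value joins the tuple, so that the graph of the function becomes a
      finitary constraint.\<close>
    define v where "v = fun_int A f xs"
    obtain k where k: "set (xs @ [v]) \<subseteq> set (P k)" using bound by blast
    let ?R = "Eq (App f (map Var [0..<length xs])) (Var (length xs))"
    have fin: "finitary_qf ?R" by (auto intro: finitary_qf.intros)
    have wf: "wf_form L ?R" "free_vars ?R \<subseteq> {..<length (xs @ [v])}" using that by auto
    have "sat A ?R (of_list (xs @ [v]))"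
      using sat_fun_of_list[of A f xs id v] by (simp add: v_def)
    from eqv_qf[OF eqv_h fin wf k this] show ?thesis
      unfolding sat_fun_of_list v_def by blast
  qed
  have "isomorphism L A A h"
    using \<open>bij h\<close> rel funs by (simp add: isomorphism_def)
  then show ?thesis using Q[of 0] P0 by blast
qed

text \<open>A solution set is closed under automorphisms, since composing one with a copy map gives
  another copy map meeting the same constraints. For a set isolating \<open>p\<close> this adds the
  inclusion that back and forth does not give.\<close>

lemma orbit_eq_val:
  assumes "\<And>p. supported p"
  shows "\<exists>P c. cond P \<and> orbit L A p = val P c"
proof -
  obtain P c where P: "cond P" "p \<in> val P c" "\<And>b. b \<in> val P c \<Longrightarrow> eqv p b"
    using supported_eqv[OF assms] by blast
  have "map h p \<in> val P c" if h: "isomorphism L A A h" for h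
  proof -
    obtain g where g: "g \<in> Mod P" "p = map g c" using P(2) by (auto simp: val_def)
    have "bij (h \<circ> g)" using Mod_bij[OF g(1)] h by (auto simp: isomorphism_def intro: bij_comp)
    moreover have "sat A \<psi> ((h \<circ> g) \<circ> \<sigma>)" if "(\<psi>, \<sigma>) \<in> P" for \<psi> \<sigma>
    proof -
      have "wf_form L \<psi>" using P(1) that basics_wf_form unfolding cond_def by blast
      moreover have "sat A \<psi> (g \<circ> \<sigma>)" using g(1) that unfolding Mod_def by blast
      ultimately show ?thesis using sat_isomorphism[OF h, of \<psi> "g \<circ> \<sigma>"] by (simp add: comp_assoc)
    qed
    ultimately have "h \<circ> g \<in> Mod P" unfolding Mod_def by blast
    then show ?thesis unfolding val_def g(2) by (intro image_eqI[of _ _ "h \<circ> g"]) auto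
  qed
  moreover have "b \<in> orbit L A p" if "b \<in> val P c" for b
    using eqv_orbit[OF assms P(3)[OF that]] by (auto simp: orbit_def)
  ultimately have "orbit L A p = val P c" by (auto simp: orbit_def)
  with P(1) show ?thesis by blast
qed

end

section \<open>The generic copy\<close>

text \<open>A stage decides a matter when all copies meeting it agree. For a function the agreed
  value is an element v of the copy, the same for every h, and not its image in A.\<close>

locale generic = scott_structure +
  fixes P :: "nat \<Rightarrow> (form \<times> (nat \<Rightarrow> nat)) set"
  assumes cond_P: "cond (P k)"
    and Mod_P: "Mod (P k) \<noteq> {}"
    and P_mono: "k \<le> l \<Longrightarrow> P k \<subseteq> P l"
    and decide_rel: "r \<in> rel_syms L \<Longrightarrow> length xs = rel_arity L r \<Longrightarrow>
      \<exists>k v. \<forall>h\<in>Mod (P k). rel_int A r (map h xs) = v"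
    and decide_fun: "f \<in> fun_syms L \<Longrightarrow> length xs = fun_arity L f \<Longrightarrow>
      \<exists>k v. \<forall>h\<in>Mod (P k). fun_int A f (map h xs) = h v"
    and decide_Disj: "Disj I \<Phi> \<in> parts \<phi> \<Longrightarrow> finsupp \<sigma> \<Longrightarrow>
      (\<And>n. n \<in> I \<Longrightarrow> \<exists>us \<psi>. \<Phi> n = Exs us \<psi> \<and> \<psi> \<in> basics) \<Longrightarrow>
      \<exists>k. (\<forall>h\<in>Mod (P k). \<not> sat A (Disj I \<Phi>) (h \<circ> \<sigma>)) \<or> (\<exists>n\<in>I. \<forall>h\<in>Mod (P k). sat A (\<Phi> n) (h \<circ> \<sigma>))"
    and decide_Exs: "\<psi> \<in> parts \<phi> \<Longrightarrow> \<psi> \<in> basics \<Longrightarrow> finsupp \<sigma> \<Longrightarrow>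
      \<exists>k. (\<forall>h\<in>Mod (P k). \<not> sat A (Exs us \<psi>) (h \<circ> \<sigma>)) \<or>
        (\<exists>\<sigma>'. finsupp \<sigma>' \<and> (\<forall>x. x \<notin> set us \<longrightarrow> \<sigma>' x = \<sigma> x) \<and> (\<forall>h\<in>Mod (P k). sat A \<psi> (h \<circ> \<sigma>')))"
begin

text \<open>\<open>eventually\<close> along this filter means: forced by some stage. The copy maps
  meeting the stages need not converge, but the atomic facts of the copies do, and \<open>B\<close>
  collects these.\<close>

definition F :: "(nat \<Rightarrow> nat) filter" where
  "F = (INF k. principal (Mod (P k)))"

lemma eventually_F: "eventually Q F \<longleftrightarrow> (\<exists>k. \<forall>h\<in>Mod (P k). Q h)"
proof -
  have "\<exists>m\<in>UNIV. principal (Mod (P m)) \<le> inf (principal (Mod (P k))) (principal (Mod (P l)))" for k l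
    using Mod_antimono[OF P_mono[of k "max k l"]] Mod_antimono[OF P_mono[of l "max k l"]]
    by (intro bexI[of _ "max k l"]) auto
  then show ?thesis
    unfolding F_def by (subst eventually_INF_base) (auto simp: eventually_principal)
qed

lemma F_neq_bot: "F \<noteq> bot"
  using Mod_P unfolding trivial_limit_def eventually_F by auto

lemma eventually_constD: "\<forall>\<^sub>F h in F. Q \<Longrightarrow> Q"
  using F_neq_bot by (simp add: eventually_const)

lemma eventually_bij: "\<forall>\<^sub>F h in F. bij h"
  unfolding eventually_F using Mod_bij by blast

definition B :: struct where
  "B = \<lparr>rel_int = (\<lambda>r xs. \<forall>\<^sub>F h in F. rel_int A r (map h xs)),
    fun_int = (\<lambda>f xs. SOME v. \<forall>\<^sub>F h in F. fun_int A f (map h xs) = h v)\<rparr>"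

lemma rel_int_B:
  assumes "r \<in> rel_syms L" "length xs = rel_arity L r"
  shows "\<forall>\<^sub>F h in F. rel_int A r (map h xs) \<longleftrightarrow> rel_int B r xs"
proof -
  obtain v where v: "\<forall>\<^sub>F h in F. rel_int A r (map h xs) = v"
    using decide_rel[OF assms] unfolding eventually_F by blast
  have "rel_int B r xs \<longleftrightarrow> v"
  proof (cases v)
    case True
    with v show ?thesis by (simp add: B_def)
  next
    case False
    have "\<not> (\<forall>\<^sub>F h in F. rel_int A r (map h xs))"
    proof
      assume "\<forall>\<^sub>F h in F. rel_int A r (map h xs)"
      with v have "\<forall>\<^sub>F h in F. False" by eventually_elim (use False in auto)
      then show False by (rule eventually_constD)
    qed
    with False show ?thesis by (simp add: B_def)
  qed
  with v show ?thesis by simp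
qed

lemma fun_int_B:
  assumes "f \<in> fun_syms L" "length xs = fun_arity L f"
  shows "\<forall>\<^sub>F h in F. fun_int A f (map h xs) = h (fun_int B f xs)"
proof -
  have "\<exists>v. \<forall>\<^sub>F h in F. fun_int A f (map h xs) = h v"
    using decide_fun[OF assms] unfolding eventually_F by blast
  from someI_ex[OF this] show ?thesis by (simp add: B_def)
qed

lemma tm_val_B: "wf_trm L t \<Longrightarrow> \<forall>\<^sub>F h in F. tm_val A (h \<circ> \<sigma>) t = h (tm_val B \<sigma> t)"
proof (induction t)
  case (App f ts)
  then have "\<forall>\<^sub>F h in F. \<forall>t\<in>set ts. tm_val A (h \<circ> \<sigma>) t = h (tm_val B \<sigma> t)"
    by (intro eventually_ball_finite finite_set ballI App.IH) auto
  moreover have "\<forall>\<^sub>F h in F. fun_int A f (map h (map (tm_val B \<sigma>) ts)) = h (fun_int B f (map (tm_val B \<sigma>) ts))"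
    using App.prems by (intro fun_int_B) auto
  ultimately show ?case
  proof eventually_elim
    case (elim h)
    then have "map (tm_val A (h \<circ> \<sigma>)) ts = map (\<lambda>t. h (tm_val B \<sigma> t)) ts" by (intro map_cong) auto
    then have "map (tm_val A (h \<circ> \<sigma>)) ts = map h (map (tm_val B \<sigma>) ts)" by (simp add: comp_def)
    with elim(2) show ?case by (simp only: tm_val.simps)
  qed
qed simp

lemma qf_B: "finitary_qf \<delta> \<Longrightarrow> wf_form L \<delta> \<Longrightarrow> \<forall>\<^sub>F h in F. sat A \<delta> (h \<circ> \<sigma>) \<longleftrightarrow> sat B \<delta> \<sigma>"
proof (induction rule: finitary_qf.induct)
  case (1 t u)
  then have "\<forall>\<^sub>F h in F. tm_val A (h \<circ> \<sigma>) t = h (tm_val B \<sigma> t)"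
    "\<forall>\<^sub>F h in F. tm_val A (h \<circ> \<sigma>) u = h (tm_val B \<sigma> u)"
    by (auto intro: tm_val_B)
  with eventually_bij show ?case
    by eventually_elim (simp only: sat.simps inj_eq[OF bij_is_inj])
next
  case (2 r ts)
  then have "\<forall>\<^sub>F h in F. \<forall>t\<in>set ts. tm_val A (h \<circ> \<sigma>) t = h (tm_val B \<sigma> t)"
    by (intro eventually_ball_finite) (auto intro: tm_val_B)
  moreover have "\<forall>\<^sub>F h in F. rel_int A r (map h (map (tm_val B \<sigma>) ts)) \<longleftrightarrow> rel_int B r (map (tm_val B \<sigma>) ts)"
    using 2 by (intro rel_int_B) auto
  ultimately show ?case
  proof eventually_elim
    case (elim h)
    then have "map (tm_val A (h \<circ> \<sigma>)) ts = map (\<lambda>t. h (tm_val B \<sigma> t)) ts" by (intro map_cong) auto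
    then have "map (tm_val A (h \<circ> \<sigma>)) ts = map h (map (tm_val B \<sigma>) ts)" by (simp add: comp_def)
    with elim(2) show ?case by (simp only: sat.simps)
  qed
next
  case (3 \<phi>)
  then have "\<forall>\<^sub>F h in F. sat A \<phi> (h \<circ> \<sigma>) \<longleftrightarrow> sat B \<phi> \<sigma>" by (intro 3) simp
  then show ?case by eventually_elim (simp only: sat.simps)
next
  case (4 \<phi> \<psi>)
  then have "\<forall>\<^sub>F h in F. sat A \<phi> (h \<circ> \<sigma>) \<longleftrightarrow> sat B \<phi> \<sigma>" "\<forall>\<^sub>F h in F. sat A \<psi> (h \<circ> \<sigma>) \<longleftrightarrow> sat B \<psi> \<sigma>" by (intro 4; simp)+
  then show ?case by eventually_elim (simp only: sat.simps)
next
  case (5 \<phi> \<psi>)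
  then have "\<forall>\<^sub>F h in F. sat A \<phi> (h \<circ> \<sigma>) \<longleftrightarrow> sat B \<phi> \<sigma>" "\<forall>\<^sub>F h in F. sat A \<psi> (h \<circ> \<sigma>) \<longleftrightarrow> sat B \<psi> \<sigma>" by (intro 5; simp)+
  then show ?case by eventually_elim (simp only: sat.simps)
qed

lemma forced_qf:
  assumes "finitary_qf \<delta>" "wf_form L \<delta>" "\<forall>\<^sub>F h in F. sat A \<delta> (h \<circ> \<sigma>)"
  shows "sat B \<delta> \<sigma>"
proof -
  from assms(3) qf_B[OF assms(1,2), of \<sigma>] have "\<forall>\<^sub>F h in F. sat B \<delta> \<sigma>"
    by eventually_elim simp
  then show ?thesis by (rule eventually_constD)
qed

text \<open>In the \<Sigma> case the level is below \<open>a\<close>, so the matrices of the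
  disjuncts are admissible constraints. The sequence has settled a disjunct and then its witnesses,
  negative decisions being incompatible with what is forced. In the \<Pi> case nothing has to be
  decided, which is why level \<open>a\<close> itself is allowed, as the Scott sentence
  requires.\<close>

lemma forced:
  "has_index L K b ys i \<psi> \<Longrightarrow> less_O b a \<or> K = PiK \<and> b = a \<Longrightarrow> \<psi> \<in> parts \<phi> \<Longrightarrow> finsupp \<sigma> \<Longrightarrow>
    \<forall>\<^sub>F h in F. sat A \<psi> (h \<circ> \<sigma>) \<Longrightarrow> sat B \<psi> \<sigma>"
proof (induction arbitrary: \<sigma> rule: has_index.induct)
  case (zero \<psi> xs K)
  then show ?case by (intro forced_qf)
next
  case (Sigma b xs e c ys \<psi>)
  have b: "less_O b a" using Sigma.prems by simp
  have parts: "Exs (part_vars n) (\<psi> n) \<in> parts \<phi>" for n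
    using part_in_parts[OF Sigma.prems(2), of n] by simp
  then have parts': "\<psi> n \<in> parts \<phi>" for n by (rule Exs_in_partsD)
  have basics: "\<psi> n \<in> basics" if n: "n \<in> W e" for n
  proof -
    have "2 ^ c n = b \<or> less_O (2 ^ c n) b" using Sigma.hyps(4)[OF n] succ_le_O by blast
    with b have "less_O (2 ^ c n) a" using less_O_trans by blast
    then show ?thesis using parts' Sigma.hyps(5)[OF n] unfolding basics_def low_def by blast
  qed
  have "\<exists>us \<chi>. Exs (part_vars n) (\<psi> n) = Exs us \<chi> \<and> \<chi> \<in> basics" if "n \<in> W e" for n
    using basics[OF that] by blast
  from decide_Disj[OF Sigma.prems(2,3) this] consider
    "\<forall>\<^sub>F h in F. \<not> sat A (Disj (W e) (\<lambda>n. Exs (part_vars n) (\<psi> n))) (h \<circ> \<sigma>)" |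
    n where "n \<in> W e" "\<forall>\<^sub>F h in F. sat A (Exs (part_vars n) (\<psi> n)) (h \<circ> \<sigma>)"
    unfolding eventually_F by blast
  then show ?case
  proof cases
    case 1
    with Sigma.prems(4) have "\<forall>\<^sub>F h in F. False" by eventually_elim blast
    then show ?thesis using eventually_constD by blast
  next
    case (2 n)
    from decide_Exs[OF parts' basics[OF 2(1)] Sigma.prems(3), of "part_vars n"] consider
      "\<forall>\<^sub>F h in F. \<not> sat A (Exs (part_vars n) (\<psi> n)) (h \<circ> \<sigma>)" |
      \<sigma>' where "finsupp \<sigma>'" "\<forall>x. x \<notin> set (part_vars n) \<longrightarrow> \<sigma>' x = \<sigma> x" "\<forall>\<^sub>F h in F. sat A (\<psi> n) (h \<circ> \<sigma>')"
      unfolding eventually_F by blast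
    then show ?thesis
    proof cases
      case 1
      with 2(2) have "\<forall>\<^sub>F h in F. False" by eventually_elim blast
      then show ?thesis using eventually_constD by blast
    next
      case (2 \<sigma>')
      have "less_O (c n) a" using Sigma.hyps(4)[OF \<open>n \<in> W e\<close>] b less_O_trans by blast
      then have "sat B (\<psi> n) \<sigma>'"
        by (rule Sigma.IH[OF \<open>n \<in> W e\<close> disjI1 parts' 2(1,3)])
      then have "sat B (Exs (part_vars n) (\<psi> n)) \<sigma>" using 2(2) unfolding sat_Exs by blast
      with \<open>n \<in> W e\<close> show ?thesis unfolding sat.simps by blast
    qed
  qed
next
  case (Pi b xs e c ys \<psi>)
  have "Alls (part_vars n) (\<psi> n) \<in> parts \<phi>" for n
    using part_in_parts[OF Pi.prems(2), of n] by simp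
  then have parts: "\<psi> n \<in> parts \<phi>" for n by (rule Alls_in_partsD)
  have "sat B (\<psi> n) \<sigma>'" if n: "n \<in> W e" and \<sigma>': "\<forall>x. x \<notin> set (part_vars n) \<longrightarrow> \<sigma>' x = \<sigma> x" for n \<sigma>'
  proof (rule Pi.IH[OF n])
    show "less_O (c n) a \<or> SigmaK = PiK \<and> c n = a"
      using Pi.hyps(4)[OF n] Pi.prems(1) less_O_trans by blast
    show "finsupp \<sigma>'" using finsupp_change[OF Pi.prems(3) finite_set] \<sigma>' by blast
    have "sat A (\<psi> n) (h \<circ> \<sigma>')" if "sat A (Conj (W e) (\<lambda>n. Alls (part_vars n) (\<psi> n))) (h \<circ> \<sigma>)" for h
    proof -
      have "sat A (Alls (part_vars n) (\<psi> n)) (h \<circ> \<sigma>)" using that n unfolding sat.simps by blast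
      then show ?thesis using \<sigma>' unfolding sat_Alls by simp
    qed
    with Pi.prems(4) show "\<forall>\<^sub>F h in F. sat A (\<psi> n) (h \<circ> \<sigma>')" by (rule eventually_mono)
  qed (rule parts)
  then show ?case unfolding sat.simps sat_Alls by blast
qed

text \<open>The Scott sentence is true in A under every assignment, hence trivially forced, hence
  true in \<open>B\<close>.\<close>

lemma isomorphic_B: "isomorphic L A B"
proof -
  have A: "models A \<phi>"
    using scott isomorphism_id unfolding scott_sentence_def isomorphic_def by blast
  have "sat B \<phi> (\<lambda>_. 0)"
    using A by (intro forced[OF index_\<phi> _ self_in_parts]) (auto simp: models_def finsupp_def)
  moreover have "sat B \<phi> s \<longleftrightarrow> sat B \<phi> (\<lambda>_. 0)" for s
    using has_index_free_vars[OF index_\<phi>] by (intro sat_cong) auto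
  ultimately have "models B \<phi>" by (simp add: models_def)
  then show ?thesis using scott unfolding scott_sentence_def by blast
qed

text \<open>The inverse of an isomorphism from A onto \<open>B\<close> meets all stages at once,
  because each constraint of a stage is forced and so true in \<open>B\<close>.\<close>

lemma generic_iso: "\<exists>h. \<forall>k. h \<in> Mod (P k)"
proof -
  obtain g where g: "isomorphism L A B g" using isomorphic_B unfolding isomorphic_def by blast
  then have bij: "bij g" by (simp add: isomorphism_def)
  have "sat A \<psi> (inv g \<circ> \<sigma>)" if "(\<psi>, \<sigma>) \<in> P k" for \<psi> \<sigma> k
  proof -
    have \<psi>: "\<psi> \<in> basics" "finsupp \<sigma>" using cond_P[of k] that unfolding cond_def by auto
    have "\<forall>\<^sub>F h in F. sat A \<psi> (h \<circ> \<sigma>)" using that unfolding eventually_F Mod_def by blast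
    moreover have "\<exists>b ys i. has_index L PiK b ys i \<psi> \<and> less_O b a"
      using \<psi>(1) less_O_succ less_O_trans has_index_in_O unfolding basics_def low_def by blast
    ultimately have "sat B \<psi> \<sigma>"
      using \<psi> forced forced_qf[OF _ basics_wf_form[OF \<psi>(1)]] unfolding basics_def by blast
    moreover have "g \<circ> (inv g \<circ> \<sigma>) = \<sigma>"
      using bij by (simp add: bij_def surj_f_inv_f fun_eq_iff)
    ultimately show ?thesis
      using sat_isomorphism[OF g basics_wf_form[OF \<psi>(1)], of "inv g \<circ> \<sigma>"] by simp
  qed
  then show ?thesis using bij_imp_bij_inv[OF bij] unfolding Mod_def by blast
qed

end

context scott_structure
begin

lemma all_supported: "supported p"
proof (rule ccontr)
  assume unsupp: "\<not> supported p"
  \<comment> \<open>The first four families supply the decisions that make the limit a model of the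
    Scott sentence; \<open>Domit c\<close> keeps \<open>p\<close> from occupying the places
    c.\<close>
  define Drel where "Drel = (\<lambda>(r, xs). {P. \<exists>v. \<forall>h\<in>Mod P. rel_int A r (map h xs) = v})"
  define Dfun where "Dfun = (\<lambda>(f, xs). {P. \<exists>v. \<forall>h\<in>Mod P. fun_int A f (map h xs) = h v})"
  define Ddisj where "Ddisj = (\<lambda>(\<chi>, \<sigma>). {P. (\<forall>h\<in>Mod P. \<not> sat A \<chi> (h \<circ> \<sigma>)) \<or>
    (\<forall>I \<Phi>. \<chi> = Disj I \<Phi> \<longrightarrow> (\<forall>n\<in>I. \<exists>us \<psi>. \<Phi> n = Exs us \<psi> \<and> \<psi> \<in> basics) \<longrightarrow>
      (\<exists>n\<in>I. \<forall>h\<in>Mod P. sat A (\<Phi> n) (h \<circ> \<sigma>)))})"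
  define Dex where "Dex = (\<lambda>(\<psi>, \<sigma>, us). {P. (\<forall>h\<in>Mod P. \<not> sat A (Exs us \<psi>) (h \<circ> \<sigma>)) \<or>
    (\<exists>\<sigma>'. finsupp \<sigma>' \<and> (\<forall>x. x \<notin> set us \<longrightarrow> \<sigma>' x = \<sigma> x) \<and> (\<forall>h\<in>Mod P. sat A \<psi> (h \<circ> \<sigma>')))})"
  define Domit where "Domit c = {P. \<forall>h\<in>Mod P. map h c \<noteq> p}" for c
  define \<D> where "\<D> = Drel ` {(r, xs). r \<in> rel_syms L \<and> length xs = rel_arity L r} \<union>
    Dfun ` {(f, xs). f \<in> fun_syms L \<and> length xs = fun_arity L f} \<union>
    Ddisj ` (parts \<phi> \<times> Collect finsupp) \<union>
    Dex ` ((parts \<phi> \<inter> basics) \<times> Collect finsupp \<times> UNIV) \<union> range Domit"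
  define ok where "ok P \<longleftrightarrow> cond P \<and> Mod P \<noteq> {}" for P
  have okI: "ok P" if "cond P" "h \<in> Mod P" for P h using that by (auto simp: ok_def)
  have count: "countable \<D>"
    unfolding \<D>_def
    by (intro countable_Un countable_image countable_SIGMA countable_parts countable_finsupp
        countable_Int1 countableI_type)
  have ok0: "ok {}" by (rule okI[OF cond_empty, of id]) (simp add: Mod_def)
  have dense: "\<exists>P'. ok P' \<and> P \<subseteq> P' \<and> P' \<in> D" if D: "D \<in> \<D>" and P: "ok P" for D P
  proof -
    from P obtain h where h: "cond P" "h \<in> Mod P" by (auto simp: ok_def)
    from D show ?thesis
      unfolding \<D>_def
    proof (elim UnE imageE rangeE)
      fix x assume x: "D = Drel x" "x \<in> {(r, xs). r \<in> rel_syms L \<and> length xs = rel_arity L r}"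
      then obtain r xs where r: "x = (r, xs)" "r \<in> rel_syms L" "length xs = rel_arity L r" by blast
      let ?R = "Rel r (map Var [0..<length xs])"
      define \<delta> where "\<delta> = (if sat A ?R (h \<circ> of_list xs) then ?R else Neg ?R)"
      have "finitary_qf \<delta>" by (auto simp: \<delta>_def intro: finitary_qf.intros)
      moreover have "wf_form L \<delta>" using r by (auto simp: \<delta>_def)
      ultimately have "cond (insert (\<delta>, of_list xs) P)"
        by (intro cond_insert h qf_in_basics finsupp_of_list)
      moreover have "h \<in> Mod (insert (\<delta>, of_list xs) P)" using h by (simp add: Mod_insert \<delta>_def)
      moreover have "rel_int A r (map k xs) = rel_int A r (map h xs)" if "k \<in> Mod (insert (\<delta>, of_list xs) P)" for k
        using that unfolding Mod_insert \<delta>_def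
        by (simp only: sat_Rel_of_list sat.simps(3) split: if_splits)
      then have "insert (\<delta>, of_list xs) P \<in> D" unfolding x(1) r(1) Drel_def by blast
      ultimately show ?thesis by (intro exI[of _ "insert (\<delta>, of_list xs) P"]) (auto intro: okI)
    next
      fix x assume x: "D = Dfun x" "x \<in> {(f, xs). f \<in> fun_syms L \<and> length xs = fun_arity L f}"
      then obtain f xs where f: "x = (f, xs)" "f \<in> fun_syms L" "length xs = fun_arity L f" by blast
      \<comment> \<open>The element of the copy given by \<open>h\<close> that names the value of
        the function.\<close>
      define v where "v = inv h (fun_int A f (map h xs))"
      define \<delta> where "\<delta> = Eq (App f (map Var [0..<length xs])) (Var (length xs))"
      have v: "fun_int A f (map h xs) = h v"
        using Mod_bij[OF h(2)] by (simp add: v_def bij_def surj_f_inv_f)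
      have "finitary_qf \<delta>" by (auto simp: \<delta>_def intro: finitary_qf.intros)
      moreover have "wf_form L \<delta>" using f by (auto simp: \<delta>_def)
      ultimately have "cond (insert (\<delta>, of_list (xs @ [v])) P)"
        by (intro cond_insert h qf_in_basics finsupp_of_list)
      moreover have "h \<in> Mod (insert (\<delta>, of_list (xs @ [v])) P)"
        unfolding Mod_insert \<delta>_def sat_fun_of_list using h v by blast
      moreover have "insert (\<delta>, of_list (xs @ [v])) P \<in> D"
        unfolding x(1) f(1) Dfun_def \<delta>_def using sat_fun_of_list by (auto simp: Mod_insert)
      ultimately show ?thesis by (intro exI[of _ "insert (\<delta>, of_list (xs @ [v])) P"]) (auto intro: okI)
    next
      fix x assume x: "D = Ddisj x" "x \<in> parts \<phi> \<times> Collect finsupp"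
      then obtain \<chi> \<sigma> where \<chi>: "x = (\<chi>, \<sigma>)" "finsupp \<sigma>" by auto
      show ?thesis
      \<comment> \<open>A condition not yet in \<open>D\<close> is met by a copy in which the
        disjunction holds; recording the witnesses of a true disjunct settles it.\<close>
      proof (cases "P \<in> D")
        case False
        then obtain k I \<Phi> where k: "k \<in> Mod P" "sat A \<chi> (k \<circ> \<sigma>)" "\<chi> = Disj I \<Phi>"
          "\<forall>n\<in>I. \<exists>us \<psi>. \<Phi> n = Exs us \<psi> \<and> \<psi> \<in> basics"
          unfolding x(1) \<chi>(1) Ddisj_def by blast
        then obtain n us \<psi> where n: "n \<in> I" "sat A (\<Phi> n) (k \<circ> \<sigma>)" "\<Phi> n = Exs us \<psi>" "\<psi> \<in> basics"
          by auto
        from extend[OF h(1) k(1) n(4) \<chi>(2)] n(2,3) obtain \<sigma>' where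
          \<sigma>': "\<forall>x. x \<notin> set us \<longrightarrow> \<sigma>' x = \<sigma> x" "cond (insert (\<psi>, \<sigma>') P)" "k \<in> Mod (insert (\<psi>, \<sigma>') P)"
          by auto
        have "sat A (\<Phi> n) (l \<circ> \<sigma>)" if "l \<in> Mod (insert (\<psi>, \<sigma>') P)" for l
          unfolding n(3) sat_Exs using that \<sigma>'(1) by (intro exI[of _ "l \<circ> \<sigma>'"]) (simp add: Mod_insert)
        then have "insert (\<psi>, \<sigma>') P \<in> D"
          using n(1) k(3) unfolding x(1) \<chi>(1) Ddisj_def by blast
        with \<sigma>' show ?thesis using okI by blast
      qed (use P in blast)
    next
      fix x assume x: "D = Dex x" "x \<in> (parts \<phi> \<inter> basics) \<times> Collect finsupp \<times> UNIV"
      then obtain \<psi> \<sigma> us where \<psi>: "x = (\<psi>, \<sigma>, us)" "\<psi> \<in> basics" "finsupp \<sigma>" by auto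
      show ?thesis
      proof (cases "P \<in> D")
        case False
        then obtain k where k: "k \<in> Mod P" "sat A (Exs us \<psi>) (k \<circ> \<sigma>)"
          unfolding x(1) \<psi>(1) Dex_def by blast
        from extend[OF h(1) k(1) \<psi>(2,3) k(2)] obtain \<sigma>' where \<sigma>': "finsupp \<sigma>'"
          "\<forall>x. x \<notin> set us \<longrightarrow> \<sigma>' x = \<sigma> x" "cond (insert (\<psi>, \<sigma>') P)" "k \<in> Mod (insert (\<psi>, \<sigma>') P)"
          by blast
        then have "insert (\<psi>, \<sigma>') P \<in> D"
          unfolding x(1) \<psi>(1) Dex_def by (auto simp: Mod_insert)
        with \<sigma>' show ?thesis using okI by blast
      qed (use P in blast)
    next
      fix c assume "D = Domit c"
      then show ?thesis
        using extend_omit[OF h(1) _ unsupp, of c] h(2) unfolding ok_def Domit_def by blast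
    qed
  qed
  have "\<exists>P. (\<forall>k. ok (P k)) \<and> (\<forall>k l :: nat. k \<le> l \<longrightarrow> P k \<subseteq> P l) \<and> (\<forall>D\<in>\<D>. \<exists>k. P k \<in> D)"
    by (rule generic_chain[where ok = ok, OF count ok0]) (rule dense)
  then obtain P where
    "\<forall>k. ok (P k)" "\<forall>k l :: nat. k \<le> l \<longrightarrow> P k \<subseteq> P l" "\<forall>D\<in>\<D>. \<exists>k. P k \<in> D"
    by blast
  then have P: "\<And>k. ok (P k)" "\<And>k l. k \<le> l \<Longrightarrow> P k \<subseteq> P l" "\<And>D. D \<in> \<D> \<Longrightarrow> \<exists>k. P k \<in> D"
    by auto
  interpret generic L A a \<phi> ix P
  proof unfold_locales
    show "cond (P k)" "Mod (P k) \<noteq> {}" for k using P(1) by (auto simp: ok_def)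
    show "P k \<subseteq> P l" if "k \<le> l" for k l using P(2) that .
    show "\<exists>k v. \<forall>h\<in>Mod (P k). rel_int A r (map h xs) = v"
      if "r \<in> rel_syms L" "length xs = rel_arity L r" for r xs
    proof -
      have "Drel (r, xs) \<in> \<D>" using that unfolding \<D>_def by blast
      from P(3)[OF this] show ?thesis by (simp add: Drel_def)
    qed
    show "\<exists>k v. \<forall>h\<in>Mod (P k). fun_int A f (map h xs) = h v"
      if "f \<in> fun_syms L" "length xs = fun_arity L f" for f xs
    proof -
      have "Dfun (f, xs) \<in> \<D>" using that unfolding \<D>_def by blast
      from P(3)[OF this] show ?thesis by (simp add: Dfun_def)
    qed
    show "\<exists>k. (\<forall>h\<in>Mod (P k). \<not> sat A (Disj I \<Phi>) (h \<circ> \<sigma>)) \<or> (\<exists>n\<in>I. \<forall>h\<in>Mod (P k). sat A (\<Phi> n) (h \<circ> \<sigma>))"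
      if "Disj I \<Phi> \<in> parts \<phi>" "finsupp \<sigma>" "\<And>n. n \<in> I \<Longrightarrow> \<exists>us \<psi>. \<Phi> n = Exs us \<psi> \<and> \<psi> \<in> basics" for I \<Phi> \<sigma>
    proof -
      have "Ddisj (Disj I \<Phi>, \<sigma>) \<in> \<D>" using that(1,2) unfolding \<D>_def by blast
      from P(3)[OF this] obtain k where "P k \<in> Ddisj (Disj I \<Phi>, \<sigma>)" ..
      then have k: "(\<forall>h\<in>Mod (P k). \<not> sat A (Disj I \<Phi>) (h \<circ> \<sigma>)) \<or>
          (\<forall>I' \<Phi>'. Disj I \<Phi> = Disj I' \<Phi>' \<longrightarrow> (\<forall>n\<in>I'. \<exists>us \<psi>. \<Phi>' n = Exs us \<psi> \<and> \<psi> \<in> basics) \<longrightarrow>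
            (\<exists>n\<in>I'. \<forall>h\<in>Mod (P k). sat A (\<Phi>' n) (h \<circ> \<sigma>)))"
        by (simp only: Ddisj_def case_prod_conv mem_Collect_eq)
      have "\<forall>n\<in>I. \<exists>us \<psi>. \<Phi> n = Exs us \<psi> \<and> \<psi> \<in> basics" using that(3) by blast
      then have "(\<forall>h\<in>Mod (P k). \<not> sat A (Disj I \<Phi>) (h \<circ> \<sigma>)) \<or>
          (\<exists>n\<in>I. \<forall>h\<in>Mod (P k). sat A (\<Phi> n) (h \<circ> \<sigma>))"
        using k by (elim disjE) (rule disjI1, assumption, rule disjI2, iprover)
      then show ?thesis ..
    qed
    show "\<exists>k. (\<forall>h\<in>Mod (P k). \<not> sat A (Exs us \<psi>) (h \<circ> \<sigma>)) \<or>
        (\<exists>\<sigma>'. finsupp \<sigma>' \<and> (\<forall>x. x \<notin> set us \<longrightarrow> \<sigma>' x = \<sigma> x) \<and> (\<forall>h\<in>Mod (P k). sat A \<psi> (h \<circ> \<sigma>')))"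
      if "\<psi> \<in> parts \<phi>" "\<psi> \<in> basics" "finsupp \<sigma>" for \<psi> \<sigma> us
    proof -
      have "Dex (\<psi>, \<sigma>, us) \<in> \<D>" using that unfolding \<D>_def by blast
      from P(3)[OF this] obtain k where "P k \<in> Dex (\<psi>, \<sigma>, us)" ..
      then show ?thesis unfolding Dex_def by (intro exI[of _ k]) simp
    qed
  qed
  \<comment> \<open>A single copy map meets every stage, so \<open>p\<close> occupies some places c
    under it, contrary to \<open>Domit c\<close>.\<close>
  obtain h where h: "\<And>k. h \<in> Mod (P k)" using generic_iso by blast
  define c where "c = map (inv h) p"
  have "map h c = p"
    using Mod_bij[OF h[of 0]] by (simp add: c_def bij_def surj_f_inv_f map_idI)
  moreover have "Domit c \<in> \<D>" unfolding \<D>_def by blast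
  from P(3)[OF this] obtain k where "P k \<in> Domit c" ..
  ultimately show False using h[of k] unfolding Domit_def by blast
qed

end

theorem theorem2p6:
  fixes L :: lang and A :: struct and a :: nat
  assumes "computable_lang L"
    and "in_O a"
    and "natLeq_on 2 \<le>o ord_O a"
    and "\<exists>\<phi>. computable_Pi L a [] \<phi> \<and> scott_sentence L A \<phi>"
  shows "\<forall>as :: nat list. \<exists>xs \<phi>. computable_Sigma_below L a xs \<phi> \<and> defines_in A xs \<phi> (orbit L A as)"
proof
  fix as :: "nat list"
  obtain \<phi> ix where "has_index L PiK a [] ix \<phi>" "scott_sentence L A \<phi>"
    using assms(4) unfolding computable_Pi_def by blast
  then interpret scott_structure L A a \<phi> ix
    using two_less_O[OF assms(3)] by unfold_locales
  obtain P c where "cond P" "orbit L A as = val P c"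
    using orbit_eq_val[OF all_supported] by blast
  then show "\<exists>xs \<phi>. computable_Sigma_below L a xs \<phi> \<and> defines_in A xs \<phi> (orbit L A as)"
    using val_definable by simp
qed

end
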